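(* Let $s,t\in\mathbb{N}$ with $2\le s\le t$. There exist $N_{s,t},R\in\mathbb{N}$ and graphs (core graphs) $G_0,\dots,G_{R-1}$, each with at most $N_{s,t}$ vertices, with designated $(t-1)$-regular components $H_j\subseteq G_j$ having $s-1$ common neighbours outside of $H_j$ (for $0\le j\le R-1$), such that for every sufficiently large $n$ there is an $(s,t)$-extremal cograph on $n$ vertices obtained by pumping $H_{(n \bmod R)}$ inside of $G_{(n\bmod R)}$. Moreover, there are constants $a_0,\dots,a_{R-1}<0$ such that for all sufficiently large $n\in\mathbb{N}$ $$\mathrm{ex}(n,\{K_{s,t},P_4\text{-ind}\}) = a_{(n\bmod R)}+\left(\frac{t-1}{2}+s-1\right)\cdot n .$$ There exists at least one residue class $q\in\mathbb{Z}/R\mathbb{Z}$ such that the $(s,t)$-extremal cographs obtained by pumping $H_q$ in $G_q$ are connected. Moreover, for every $n\in\mathbb{N}$ $$\mathrm{ex}(n,\{K_{s,t},P_4\text{-ind}\}) < \left(\frac{t-1}{2}+s-1\right)\cdot n .$$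
   Context: Graphs are finite and simple; $\mathbb{N}=\{1,2,\dots\}$; $n\bmod R\in\{0,\dots,R-1\}$ also denotes the residue class of $n$. A cograph is a graph with no induced path $P_4$ on four vertices. $K_{s,t}$ is the complete bipartite graph with parts of sizes $s$ and $t$. A graph contains $H$ if it has a (not necessarily induced) subgraph isomorphic to $H$, and is $H$-free otherwise. For $s\le t$, a cograph is $(s,t)$-extremal if it has the maximum number of edges among all cographs with the same number of vertices not containing $K_{s,t}$. $\mathrm{ex}(n,\{K_{s,t},P_4\text{-ind}\})$ is the maximum number of edges of an $n$-vertex graph that is $K_{s,t}$-free and has no induced $P_4$. Component (designated component): a nonempty induced subgraph $H_j$ of $G_j$ all of whose vertices have exactly the same neighbourhood in $V(G_j)\setminus V(H_j)$; it need not be a connected component of $G_j$. That it has $s-1$ common neighbours outside of $H_j$ means that this common outside neighbourhood consists of $s-1$ vertices. $(t-1)$-regular refers to $H_j$ as a graph in itself. Pumping: let $G$ be a graph and $H\subseteq G$ a subgraph. Pumping $H$ in $G$ $k$ times gives the graph $G'$ obtained from $G$ by adding $k$ copies of $H$, where in each copy every vertex is joined to the neighbours in $V(G)\setminus V(H)$ of its corresponding vertex of $H$. Formally, with $H_1,\dots,H_{k+1}$ disjoint copies of $H$, $V(G')=(V(G)\setminus V(H))\cup\bigcup_{j=1}^{k+1}V(H_j)$, and the edges of $G'$ are the edges of $G-V(H)$, the edges of each $H_j$, and all edges $v'w$ with $v'\in V(H_j)$ the copy of $v\in V(H)$ and $w\in V(G)\setminus V(H)$ a neighbour of $v$ in $G$.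 A graph is obtained by pumping $H$ inside $G$ if it arises by pumping $H$ in $G$ $k$ times for some $k$. *)

theory Defs
  imports Complex_Main
begin

section \<open>Finite simple graphs\<close>

record 'a ugraph =
  verts :: "'a set"
  edges :: "'a set set"

definition simple_graph :: "'a ugraph \<Rightarrow> bool" where
  "simple_graph G \<longleftrightarrow> finite (verts G) \<and> (\<forall>e\<in>edges G. e \<subseteq> verts G \<and> card e = 2)"

definition neighbours :: "'a ugraph \<Rightarrow> 'a \<Rightarrow> 'a set" where
  "neighbours G v = {w \<in> verts G. {v, w} \<in> edges G}"

definition regular :: "nat \<Rightarrow> 'a ugraph \<Rightarrow> bool" where
  "regular d G \<longleftrightarrow> (\<forall>v\<in>verts G. card (neighbours G v) = d)"

definition graph_connected :: "'a ugraph \<Rightarrow> bool" where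
  "graph_connected G \<longleftrightarrow> verts G \<noteq> {} \<and>
     (\<forall>u\<in>verts G. \<forall>v\<in>verts G. (u, v) \<in> {(x, y). {x, y} \<in> edges G}\<^sup>*)"

definition subgraph :: "'a ugraph \<Rightarrow> 'a ugraph \<Rightarrow> bool" where
  "subgraph H G \<longleftrightarrow> simple_graph H \<and> verts H \<subseteq> verts G \<and> edges H \<subseteq> edges G"

definition induced :: "'a ugraph \<Rightarrow> 'a set \<Rightarrow> 'a ugraph" where
  "induced G W = \<lparr>verts = W, edges = {e \<in> edges G. e \<subseteq> W}\<rparr>"

definition isomorphic :: "'a ugraph \<Rightarrow> 'b ugraph \<Rightarrow> bool" where
  "isomorphic G H \<longleftrightarrow>
     (\<exists>f. bij_betw f (verts G) (verts H) \<and> edges H = (\<lambda>e. f ` e) ` edges G)"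

definition contains_graph :: "'a ugraph \<Rightarrow> 'b ugraph \<Rightarrow> bool" where
  "contains_graph G H \<longleftrightarrow> (\<exists>H'. subgraph H' G \<and> isomorphic H' H)"

definition contains_induced :: "'a ugraph \<Rightarrow> 'b ugraph \<Rightarrow> bool" where
  "contains_induced G H \<longleftrightarrow> (\<exists>W\<subseteq>verts G. isomorphic (induced G W) H)"

definition complete_bipartite :: "nat \<Rightarrow> nat \<Rightarrow> (nat + nat) ugraph" where
  "complete_bipartite s t =
     \<lparr>verts = {..<s} <+> {..<t}, edges = {{Inl i, Inr j} | i j. i < s \<and> j < t}\<rparr>"

text \<open>The argument counts vertices, so \<open>path_graph 4\<close> is $P_4$.\<close>

definition path_graph :: "nat \<Rightarrow> nat ugraph" where
  "path_graph m = \<lparr>verts = {..<m}, edges = {{i, Suc i} | i. Suc i < m}\<rparr>"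

definition cograph :: "'a ugraph \<Rightarrow> bool" where
  "cograph G \<longleftrightarrow> simple_graph G \<and> \<not> contains_induced G (path_graph 4)"


section \<open>Extremal cographs\<close>

text \<open>
  Every finite graph is isomorphic to one with vertices in \<^typ>\<open>nat\<close>, so maxima over all graphs
  of a given order are taken over graphs with vertices in \<^typ>\<open>nat\<close>. For \<open>s, t \<ge> 1\<close> the set
  in \<open>ex_cograph\<close> is finite and nonempty (it contains the edge number of the edgeless graph),
  so \<^const>\<open>Max\<close> is meaningful.
\<close>

definition extremal_cograph :: "nat \<Rightarrow> nat \<Rightarrow> 'a ugraph \<Rightarrow> bool" where
  "extremal_cograph s t G \<longleftrightarrow>
     cograph G \<and> \<not> contains_graph G (complete_bipartite s t) \<and>
     (\<forall>G' :: nat ugraph. cograph G' \<and> \<not> contains_graph G' (complete_bipartite s t) \<and>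
        card (verts G') = card (verts G) \<longrightarrow> card (edges G') \<le> card (edges G))"

definition ex_cograph :: "nat \<Rightarrow> nat \<Rightarrow> nat \<Rightarrow> nat" where
  "ex_cograph n s t = Max {card (edges G) | G :: nat ugraph.
     simple_graph G \<and> card (verts G) = n \<and>
     \<not> contains_graph G (complete_bipartite s t) \<and> \<not> contains_induced G (path_graph 4)}"


section \<open>Components and pumping\<close>

text \<open>A component in this sense is a homogeneous set (module) with its induced graph; it need
  not be a connected component.\<close>

definition is_component :: "'a ugraph \<Rightarrow> 'a ugraph \<Rightarrow> bool" where
  "is_component H G \<longleftrightarrow>
     verts H \<noteq> {} \<and> verts H \<subseteq> verts G \<and> H = induced G (verts H) \<and>
     (\<forall>u\<in>verts H. \<forall>v\<in>verts H. neighbours G u - verts H = neighbours G v - verts H)"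

definition common_outside_neighbours :: "'a ugraph \<Rightarrow> 'a ugraph \<Rightarrow> 'a set" where
  "common_outside_neighbours H G = {w \<in> verts G - verts H. \<forall>v\<in>verts H. w \<in> neighbours G v}"

text \<open>
  \<open>Inl w\<close> is the vertex \<open>w\<close> outside \<open>H\<close>, and \<open>Inr (v, j)\<close> is the vertex corresponding to \<open>v\<close> in
  the \<open>j\<close>-th of the \<open>k + 1\<close> copies of \<open>H\<close>; \<open>k = 0\<close> yields a graph isomorphic to \<open>G\<close> if \<open>H\<close> is
  an induced subgraph.
\<close>

definition pump :: "'a ugraph \<Rightarrow> 'a ugraph \<Rightarrow> nat \<Rightarrow> ('a + 'a \<times> nat) ugraph" where
  "pump H G k =
     \<lparr>verts = Inl ` (verts G - verts H) \<union> Inr ` (verts H \<times> {1..k+1}),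
      edges =
        {{Inl u, Inl w} | u w. u \<in> verts G - verts H \<and> w \<in> verts G - verts H \<and> {u, w} \<in> edges G}
      \<union> {{Inr (u, j), Inr (v, j)} | u v j. j \<in> {1..k+1} \<and> {u, v} \<in> edges H}
      \<union> {{Inr (v, j), Inl w} | v w j. j \<in> {1..k+1} \<and> v \<in> verts H \<and>
            w \<in> verts G - verts H \<and> {v, w} \<in> edges G}\<rparr>"

end

theory Submission
  imports Defs
begin

text \<open>
  A \<open>P\<^sub>4\<close>-free graph with at least two vertices is disconnected or a join. Call the defect of a
  graph on \<open>n\<close> vertices \<open>(t - 1 + 2 (s - 1)) n\<close> minus its degree sum. Defects add up over disjoint
  unions, and in a \<open>K\<^bsub>s,t\<^esub>\<close>-free join of \<open>A\<close> with \<open>B\<close>, where \<open>|A| < s\<close>, the set \<open>B\<close> is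
  \<open>K\<^bsub>s-|A|,t\<^esub>\<close>-free and its defect for the parameters \<open>s - |A|, t\<close> drops by at least \<open>|A|\<close>. By
  induction the defect is nonnegative, positive for \<open>s \<ge> 2\<close>, and a \<open>K\<^bsub>s,t\<^esub>\<close>-free cograph with more than \<open>2 t\<close> times its defect
  many vertices has a \<open>(t - 1)\<close>-regular module with at most \<open>2 t\<close> vertices and exactly \<open>s - 1\<close>
  outside neighbours. Pumping this module preserves the defect and \<open>K\<^bsub>s,t\<^esub>\<close>-freeness.

  Pumping \<open>K\<^sub>t\<close> inside \<open>K\<^bsub>s+t-1\<^esub>\<close> bounds the minimal defect \<open>g n\<close> from above, so every large extremal
  cograph has such a module. With \<open>R = (2 t)!\<close> this gives \<open>g (n + R) \<le> g n\<close>, hence \<open>g\<close> is eventually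
  constant on residue classes, and an extremal cograph minimising \<open>g\<close> in its class is a core graph.
  In the class where this minimum is smallest a disconnected extremal graph would have a large
  part with smaller defect.
\<close>

section \<open>Forbidden patterns for adjacency relations, and splitting into a union or a
  join\<close>

section \<open>Splitting cographs\<close>

text \<open>Stated for a relation and a vertex set, so that it applies equally to a graph, to its
  complement relation and to any vertex subset.\<close>

definition p4_free :: "('a \<Rightarrow> 'a \<Rightarrow> bool) \<Rightarrow> 'a set \<Rightarrow> bool" where
  "p4_free r V \<longleftrightarrow> \<not> (\<exists>a\<in>V. \<exists>b\<in>V. \<exists>c\<in>V. \<exists>d\<in>V. distinct [a, b, c, d] \<and>
      r a b \<and> r b c \<and> r c d \<and> \<not> r a c \<and> \<not> r b d \<and> \<not> r a d)"

text \<open>Disjointness of the sides is left out: for irreflexive \<open>r\<close> a complete pair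
  is disjoint automatically. Nothing is demanded inside a side, in line with containment that need
  not be induced.\<close>

definition biclique_free :: "('a \<Rightarrow> 'a \<Rightarrow> bool) \<Rightarrow> nat \<Rightarrow> nat \<Rightarrow> 'a set \<Rightarrow> bool" where
  "biclique_free r p q V \<longleftrightarrow>
     \<not> (\<exists>A B. A \<subseteq> V \<and> B \<subseteq> V \<and> card A = p \<and> card B = q \<and> (\<forall>a\<in>A. \<forall>b\<in>B. r a b))"

text \<open>For \<open>A = B = V\<close> every edge is counted twice, which keeps the bounds
  integral; for disjoint sets it counts the pairs between them.\<close>

definition degree_sum :: "('a \<Rightarrow> 'a \<Rightarrow> bool) \<Rightarrow> 'a set \<Rightarrow> 'a set \<Rightarrow> nat" where
  "degree_sum r A B = (\<Sum>u\<in>A. card {v \<in> B. r u v})"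

definition bipartition :: "'a set \<Rightarrow> 'a set \<Rightarrow> 'a set \<Rightarrow> bool" where
  "bipartition V A B \<longleftrightarrow> A \<union> B = V \<and> A \<inter> B = {} \<and> A \<noteq> {} \<and> B \<noteq> {}"

lemma bipartition_sym: "bipartition V A B \<Longrightarrow> bipartition V B A"
  unfolding bipartition_def by auto

lemma bipartition_card:
  assumes "bipartition V A B" "finite V"
  shows "finite A" "finite B" "1 \<le> card A" "1 \<le> card B" "card V = card A + card B"
proof -
  from assms show f: "finite A" "finite B" by (auto simp: bipartition_def)
  with assms show "1 \<le> card A" "1 \<le> card B"
    by (auto simp: bipartition_def Suc_le_eq card_gt_0_iff)
  from assms f show "card V = card A + card B"
    by (auto simp: bipartition_def card_Un_disjoint)
qed

lemma p4_freeD: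
  assumes "p4_free r V" "a \<in> V" "b \<in> V" "c \<in> V" "d \<in> V" "distinct [a, b, c, d]"
    "r a b" "r b c" "r c d" "\<not> r a c" "\<not> r b d" "\<not> r a d"
  shows False
  using assms(1)[unfolded p4_free_def] assms(2-) by meson

lemma p4_freeI:
  assumes "\<And>a b c d. \<lbrakk>a \<in> V; b \<in> V; c \<in> V; d \<in> V; distinct [a, b, c, d];
    r a b; r b c; r c d; \<not> r a c; \<not> r b d; \<not> r a d\<rbrakk> \<Longrightarrow> False"
  shows "p4_free r V"
  using assms unfolding p4_free_def by metis

lemma biclique_freeD:
  assumes "biclique_free r p q V" "A \<subseteq> V" "B \<subseteq> V" "card A = p" "card B = q"
    "\<And>a b. a \<in> A \<Longrightarrow> b \<in> B \<Longrightarrow> r a b"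
  shows False
  using assms unfolding biclique_free_def by metis

lemma biclique_freeI:
  assumes "\<And>A B. \<lbrakk>A \<subseteq> V; B \<subseteq> V; card A = p; card B = q;
    \<And>a b. a \<in> A \<Longrightarrow> b \<in> B \<Longrightarrow> r a b\<rbrakk> \<Longrightarrow> False"
  shows "biclique_free r p q V"
  using assms unfolding biclique_free_def by metis

lemma p4_free_subset:
  assumes "p4_free r V" "W \<subseteq> V"
  shows "p4_free r W"
proof (rule p4_freeI, goal_cases)
  case (1 a b c d)
  then show ?case using p4_freeD[OF assms(1), of a b c d] assms(2) by blast
qed

lemma biclique_free_subset:
  assumes "biclique_free r p q V" "W \<subseteq> V"
  shows "biclique_free r p q W"
proof (rule biclique_freeI, goal_cases)
  case (1 A B)
  then show ?case using biclique_freeD[OF assms(1), of A B] assms(2) by blast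
qed

lemma biclique_free_sym:
  assumes "symp r" "biclique_free r p q V"
  shows "biclique_free r q p V"
proof (rule biclique_freeI, goal_cases)
  case (1 A B)
  then show ?case using biclique_freeD[OF assms(2), of B A] sympD[OF assms(1)] by blast
qed

text \<open>The path on four vertices is self-complementary: an induced path \<open>a b c d\<close>
  of non-edges is the path \<open>c a d b\<close> of edges.\<close>

lemma p4_free_complement:
  assumes "symp r" "p4_free r V"
  shows "p4_free (\<lambda>x y. \<not> r x y) V"
proof (rule p4_freeI, goal_cases)
  case (1 a b c d)
  then have "distinct [c, a, d, b]" "r c a" "r a d" "r d b" "\<not> r c d" "\<not> r a b" "\<not> r c b"
    using sympD[OF assms(1)] by auto
  with 1(1-4) show ?case using p4_freeD[OF assms(2), of c a d b] by blast
qed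

text \<open>If \<open>v\<close> is not joined to all of \<open>W\<close>, let \<open>C\<close> be
  the component in \<open>W\<close> of a non-neighbour \<open>w\<close> of \<open>v\<close>. Either
  \<open>v\<close> has no neighbour in \<open>C\<close>, and \<open>C\<close> splits off, or an
  induced path is avoided only if \<open>v\<close> has no neighbour in \<open>W - C\<close>, and
  \<open>W - C\<close> splits off. The relation \<open>r\<close> may be a graph or its
  complement.\<close>

lemma p4_free_extend_split:
  assumes r: "symp r" and free: "p4_free r (insert v W)" and v: "v \<notin> W"
    and AB: "bipartition W A B" and sep: "\<forall>a\<in>A. \<forall>b\<in>B. \<not> r a b"
  shows "\<exists>A B. bipartition (insert v W) A B \<and>
    ((\<forall>a\<in>A. \<forall>b\<in>B. r a b) \<or> (\<forall>a\<in>A. \<forall>b\<in>B. \<not> r a b))"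
proof (cases "\<forall>w\<in>W. r v w")
  case True
  have "bipartition (insert v W) {v} W" using AB v by (auto simp: bipartition_def)
  with True show ?thesis by blast
next
  case False
  then obtain w where w: "w \<in> W" "\<not> r v w" by blast
  define C where "C = {u. (w, u) \<in> {(x, y). x \<in> W \<and> y \<in> W \<and> r x y}\<^sup>*}"
  have wC: "w \<in> C" by (simp add: C_def)
  have step: "y \<in> C" if "x \<in> C" "x \<in> W" "y \<in> W" "r x y" for x y
    using that unfolding C_def by (auto intro: rtrancl_into_rtrancl)
  have ind: "u \<in> P" if "u \<in> C" "w \<in> P" "\<And>x y. x \<in> P \<Longrightarrow> x \<in> C \<Longrightarrow> x \<in> W \<Longrightarrow> y \<in> W \<Longrightarrow> r x y \<Longrightarrow> y \<in> P" for u P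
  proof -
    have "(w, u) \<in> {(x, y). x \<in> W \<and> y \<in> W \<and> r x y}\<^sup>*" using that(1) by (simp add: C_def)
    then show ?thesis
      by induction (use that(2,3) in \<open>auto simp: C_def\<close>)
  qed
  have CW: "C \<subseteq> W" using ind[of _ W] w by blast
  have "C \<noteq> W"
  proof
    assume "C = W"
    have sep': "\<not> r b a" if "a \<in> A" "b \<in> B" for a b
      using sep that r by (auto dest: sympD)
    show False
    proof (cases "w \<in> A")
      case True
      then have "C \<subseteq> A" using ind[of _ A] sep AB by (auto simp: bipartition_def)
      with AB \<open>C = W\<close> show ?thesis by (auto simp: bipartition_def)
    next
      case False
      then have "w \<in> B" using w AB by (auto simp: bipartition_def)
      then have "C \<subseteq> B" using ind[of _ B] sep' AB by (auto simp: bipartition_def)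
      with AB \<open>C = W\<close> show ?thesis by (auto simp: bipartition_def)
    qed
  qed
  then obtain z0 where z0: "z0 \<in> W - C" using CW by blast
  have sepC: "\<not> r c z" if "c \<in> C" "z \<in> W - C" for c z
    using step that CW by blast
  show ?thesis
  proof (cases "\<exists>x\<in>C. r v x")
    case False
    have "bipartition (insert v W) C (insert v (W - C))"
      using CW wC v by (auto simp: bipartition_def)
    moreover have "\<forall>a\<in>C. \<forall>b\<in>insert v (W - C). \<not> r a b"
      using False sepC r by (auto dest: sympD)
    ultimately show ?thesis by blast
  next
    case True
    \<comment> \<open>\<open>C\<close> is connected and contains both a neighbour of
      \<open>v\<close> and the non-neighbour \<open>w\<close>. Without such an edge
      \<open>x y\<close>, non-adjacency to \<open>v\<close> would spread from \<open>w\<close> over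
      all of \<open>C\<close>.\<close>
    have "\<exists>x\<in>C. \<exists>y\<in>C. r v x \<and> \<not> r v y \<and> r x y"
    proof (rule ccontr)
      assume no: "\<not> ?thesis"
      have "C \<subseteq> {u. \<not> r v u}"
      proof
        fix u assume "u \<in> C"
        then show "u \<in> {u. \<not> r v u}"
        proof (rule ind)
          show "w \<in> {u. \<not> r v u}" using w by simp
        next
          fix x y assume "x \<in> {u. \<not> r v u}" "x \<in> C" "x \<in> W" "y \<in> W" "r x y"
          then show "y \<in> {u. \<not> r v u}"
            using no step[of x y] sympD[OF r, of x y] by blast
        qed
      qed
      with True show False by blast
    qed
    then obtain x y where xy: "x \<in> C" "y \<in> C" "r v x" "\<not> r v y" "r x y" by blast
    \<comment> \<open>A neighbour \<open>z\<close> of \<open>v\<close> outside \<open>C\<close>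
      would give the induced path \<open>z v x y\<close>.\<close>
    have nz: "\<not> r v z" if z: "z \<in> W - C" for z
    proof
      assume vz: "r v z"
      have "\<not> r z x" "\<not> r z y" "r z v"
        using sepC z xy vz r by (auto dest: sympD)
      moreover have "x \<noteq> y" using xy by blast
      moreover have "distinct [z, v, x, y]" using \<open>x \<noteq> y\<close> z xy v CW by auto
      ultimately show False
        using p4_freeD[OF free, of z v x y] xy z CW vz by blast
    qed
    have "bipartition (insert v W) (W - C) (insert v C)"
      using CW z0 v by (auto simp: bipartition_def)
    moreover have "\<forall>a\<in>W - C. \<forall>b\<in>insert v C. \<not> r a b"
      using nz sepC r by (auto dest: sympD)
    ultimately show ?thesis by blast
  qed
qed

text \<open>Induction over the vertices. A join of \<open>W\<close> is a separation for the
  complement relation, so a single extension lemma serves both kinds of split.\<close>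

lemma p4_free_split:
  assumes "finite V" "2 \<le> card V" "symp r" "p4_free r V"
  shows "\<exists>A B. bipartition V A B \<and>
    ((\<forall>a\<in>A. \<forall>b\<in>B. r a b) \<or> (\<forall>a\<in>A. \<forall>b\<in>B. \<not> r a b))"
  using assms
proof (induction V rule: finite_induct)
  case empty
  then show ?case by simp
next
  case (insert v W)
  show ?case
  proof (cases "2 \<le> card W")
    case True
    have "p4_free r W" using insert.prems p4_free_subset by blast
    with True insert obtain A B where AB: "bipartition W A B"
      "(\<forall>a\<in>A. \<forall>b\<in>B. r a b) \<or> (\<forall>a\<in>A. \<forall>b\<in>B. \<not> r a b)" by blast
    from AB(2) show ?thesis
    proof
      assume "\<forall>a\<in>A. \<forall>b\<in>B. \<not> r a b"
      with insert.prems insert.hyps AB(1) show ?thesis by (intro p4_free_extend_split)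
    next
      assume join: "\<forall>a\<in>A. \<forall>b\<in>B. r a b"
      have "symp (\<lambda>x y. \<not> r x y)" using insert.prems by (auto simp: symp_def)
      then have "\<exists>A B. bipartition (insert v W) A B \<and>
        ((\<forall>a\<in>A. \<forall>b\<in>B. \<not> r a b) \<or> (\<forall>a\<in>A. \<forall>b\<in>B. \<not> \<not> r a b))"
        using p4_free_complement[OF insert.prems(2,3)] insert.hyps(2) AB(1) join
        by (intro p4_free_extend_split) auto
      then show ?thesis by (simp only: not_not) blast
    qed
  next
    case False
    with insert have "card W = 1" by simp
    then obtain w where W: "W = {w}" by (auto simp: card_1_singleton_iff)
    have "bipartition (insert v W) {v} {w}" using W insert by (auto simp: bipartition_def)
    then show ?thesis by blast
  qed
qed

section \<open>Degree sums\<close>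

lemma degree_sum_bipartition:
  assumes "bipartition V A B" "finite V"
  shows "degree_sum r V V =
    degree_sum r A A + degree_sum r A B + degree_sum r B A + degree_sum r B B"
proof -
  have V: "V = A \<union> B" "A \<inter> B = {}" "finite A" "finite B"
    using assms by (auto simp: bipartition_def)
  have "card {v \<in> V. r u v} = card {v \<in> A. r u v} + card {v \<in> B. r u v}" for u
  proof -
    have "{v \<in> V. r u v} = {v \<in> A. r u v} \<union> {v \<in> B. r u v}" using V by auto
    then show ?thesis using V by (auto intro: card_Un_disjoint)
  qed
  then show ?thesis
    using V by (simp add: degree_sum_def sum.union_disjoint sum.distrib)
qed

lemma degree_sum_complete: "\<forall>a\<in>A. \<forall>b\<in>B. r a b \<Longrightarrow> degree_sum r A B = card A * card B"
proof -
  assume "\<forall>a\<in>A. \<forall>b\<in>B. r a b"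
  then have "\<And>a. a \<in> A \<Longrightarrow> {b \<in> B. r a b} = B" by auto
  then show ?thesis by (simp add: degree_sum_def)
qed

lemma degree_sum_empty: "\<forall>a\<in>A. \<forall>b\<in>B. \<not> r a b \<Longrightarrow> degree_sum r A B = 0"
proof -
  assume "\<forall>a\<in>A. \<forall>b\<in>B. \<not> r a b"
  then have "\<And>a. a \<in> A \<Longrightarrow> {b \<in> B. r a b} = {}" by auto
  then show ?thesis unfolding degree_sum_def by (metis (no_types, lifting) card.empty sum.neutral)
qed

lemma degree_sum_join:
  assumes "bipartition V A B" "finite V" "symp r" "\<forall>a\<in>A. \<forall>b\<in>B. r a b"
  shows "degree_sum r V V = degree_sum r A A + degree_sum r B B + 2 * (card A * card B)"
proof -
  have "\<forall>b\<in>B. \<forall>a\<in>A. r b a" using assms by (auto dest: sympD)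
  then show ?thesis
    using degree_sum_bipartition[OF assms(1,2)] assms(4) by (simp add: degree_sum_complete)
qed

lemma degree_sum_separated:
  assumes "bipartition V A B" "finite V" "symp r" "\<forall>a\<in>A. \<forall>b\<in>B. \<not> r a b"
  shows "degree_sum r V V = degree_sum r A A + degree_sum r B B"
proof -
  have "\<forall>b\<in>B. \<forall>a\<in>A. \<not> r b a" using assms by (auto dest: sympD)
  then show ?thesis
    using degree_sum_bipartition[OF assms(1,2)] assms(4) by (simp add: degree_sum_empty)
qed

lemma degree_sum_le_complete:
  assumes "finite A" "irreflp r"
  shows "degree_sum r A A \<le> card A * (card A - 1)"
proof -
  have "card {v \<in> A. r u v} \<le> card A - 1" if "u \<in> A" for u
  proof -
    have "{v \<in> A. r u v} \<subseteq> A - {u}" using assms by (auto dest: irreflpD)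
    then show ?thesis using assms that card_mono[of "A - {u}"] by fastforce
  qed
  then show ?thesis
    unfolding degree_sum_def using sum_bounded_above[of A _ "card A - 1"] by simp
qed

section \<open>Bicliques in joins and the linear bound on degree sums\<close>

lemma biclique_free_join_rest:
  assumes free: "biclique_free r p q V" and V: "bipartition V A B" "finite V"
    and join: "\<forall>a\<in>A. \<forall>b\<in>B. r a b" and "card A < p"
  shows "biclique_free r (p - card A) q B"
proof (rule biclique_freeI, goal_cases)
  case (1 C D)
  have "finite A" "finite B" "A \<inter> B = {}" using V by (auto simp: bipartition_def)
  \<comment> \<open>\<open>A\<close> is completely joined to \<open>D\<close>, so it enlarges the
    side \<open>C\<close> of a biclique inside \<open>B\<close>.\<close>
  then have "card (A \<union> C) = p"
    using 1 assms(5) by (subst card_Un_disjoint) (auto intro: finite_subset)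
  moreover have "A \<union> C \<subseteq> V" "D \<subseteq> V" using 1 V by (auto simp: bipartition_def)
  moreover have "\<And>a b. a \<in> A \<union> C \<Longrightarrow> b \<in> D \<Longrightarrow> r a b" using 1 join by auto
  ultimately show ?case using biclique_freeD[OF free] 1 by blast
qed

lemma biclique_free_join_sizes:
  assumes free: "biclique_free r p q V" and V: "bipartition V A B"
    and join: "\<forall>a\<in>A. \<forall>b\<in>B. r a b" and "p \<le> card A"
  shows "card B < q"
proof (rule ccontr)
  assume "\<not> card B < q"
  then obtain D where "D \<subseteq> B" "card D = q" by (meson not_less obtain_subset_with_card_n)
  moreover obtain C where "C \<subseteq> A" "card C = p"
    using \<open>p \<le> card A\<close> by (meson obtain_subset_with_card_n)
  moreover have "A \<subseteq> V" "B \<subseteq> V" using V by (auto simp: bipartition_def)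
  ultimately show False
    using biclique_freeD[OF free, of C D] join by blast
qed

lemma degree_le_of_star_free:
  assumes "biclique_free r 1 q V" "1 \<le> q" "v \<in> V"
  shows "card {w \<in> V. r v w} \<le> q - 1"
proof (rule ccontr)
  assume "\<not> ?thesis"
  then have "q \<le> card {w \<in> V. r v w}" by simp
  then obtain D where "D \<subseteq> {w \<in> V. r v w}" "card D = q" by (metis obtain_subset_with_card_n)
  then show False
    using assms(3) by (intro biclique_freeD[OF assms(1), of "{v}" D]) auto
qed

text \<open>Passing from \<open>V\<close> to \<open>B\<close> lowers \<open>p\<close> by
  \<open>card A\<close> and the coefficient by \<open>2 * card A\<close>, which pays exactly for the
  pairs between \<open>A\<close> and \<open>B\<close>. The vertices of \<open>A\<close> leave a
  surplus of at least \<open>card A\<close>, because their internal degree sum is at most that of a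
  complete graph. Hence the defect drops by at least \<open>card A\<close>.\<close>

lemma degree_sum_bound_join_small:
  assumes r: "symp r" "irreflp r" and V: "finite V" "bipartition V A B"
    and join: "\<forall>a\<in>A. \<forall>b\<in>B. r a b" and small: "card A < p" and "p \<le> q"
    and IH: "int (degree_sum r B B) \<le> (int q + 2 * int (p - card A) - 3) * int (card B)"
  shows "int (degree_sum r V V) + int (card A) \<le> (int q + 2 * int p - 3) * int (card V)
    - ((int q + 2 * int (p - card A) - 3) * int (card B) - int (degree_sum r B B))"
proof -
  define a b where "a = int (card A)" and "b = int (card B)"
  note c = bipartition_card[OF V(2,1)]
  have a: "1 \<le> a" "int (p - card A) = int p - a" "a < int p"
    using c small by (auto simp: a_def of_nat_diff)
  have "int (degree_sum r A A) \<le> int (card A * (card A - 1))"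
    using degree_sum_le_complete[OF c(1) r(2)] by (simp only: of_nat_le_iff)
  also have "\<dots> = a * (a - 1)" using c by (simp add: a_def of_nat_diff)
  finally have x: "int (degree_sum r A A) \<le> a * (a - 1)" .
  \<comment> \<open>This is the surplus: \<open>a * (a - 1) + a = a * a\<close>, and
    \<open>a < p\<close> keeps \<open>a\<close> below the coefficient.\<close>
  have "a * a \<le> (int q + 2 * int p - 3) * a"
    using a \<open>p \<le> q\<close> by (intro mult_right_mono) auto
  moreover have "int (degree_sum r V V) =
      int (degree_sum r A A) + int (degree_sum r B B) + 2 * (a * b)"
    using degree_sum_join[OF V(2,1) r(1) join] by (simp add: a_def b_def)
  moreover have "int (card V) = a + b" using c by (simp add: a_def b_def)
  ultimately show ?thesis
    using x unfolding a(2) b_def[symmetric] a_def[symmetric] by (simp add: algebra_simps)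
qed

text \<open>Induction on the number of vertices, with \<open>p\<close> and \<open>q\<close> varying.
  For \<open>p = 1\<close> all degrees are at most \<open>q - 1\<close>. In a disjoint union the
  bounds add. A join with a side smaller than \<open>p\<close> reduces to its other side. Otherwise
  both sides are smaller than \<open>q\<close>, and bounds for the two sides with \<open>q\<close>
  lowered by the opposite size are added.\<close>

lemma degree_sum_bound:
  assumes "symp r" "irreflp r" "finite V" "V \<noteq> {}" "p4_free r V" "biclique_free r p q V"
    "1 \<le> p" "p \<le> q"
  shows "int (degree_sum r V V) + (if 2 \<le> p then 1 else 0) \<le> (int q + 2 * int p - 3) * int (card V)"
  using assms(3-)
proof (induction "card V" arbitrary: V p q rule: less_induct)
  case less
  note r = assms(1,2)
  show ?case
  proof (cases "p = 1")
    case True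
    then have "card {w \<in> V. r v w} \<le> q - 1" if "v \<in> V" for v
      using degree_le_of_star_free[of r q V v] less.prems that by simp
    then have "degree_sum r V V \<le> card V * (q - 1)"
      unfolding degree_sum_def using sum_bounded_above[of V _ "q - 1"] by simp
    then have "int (degree_sum r V V) \<le> int (card V * (q - 1))"
      by (simp only: of_nat_le_iff)
    also have "\<dots> = (int q - 1) * int (card V)"
      using less.prems by (simp add: of_nat_diff)
    finally show ?thesis using True by simp
  next
    case False
    with less.prems have p: "2 \<le> p" by simp
    show ?thesis
    proof (cases "2 \<le> card V")
      case False
      moreover have "card V \<noteq> 0" using less.prems by simp
      ultimately have "card V = 1" by linarith
      then show ?thesis
        using degree_sum_le_complete[OF less.prems(1) r(2)] p less.prems by simp
    next
      case True
      then obtain A B where AB: "bipartition V A B"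
        and dich: "(\<forall>a\<in>A. \<forall>b\<in>B. r a b) \<or> (\<forall>a\<in>A. \<forall>b\<in>B. \<not> r a b)"
        using p4_free_split[OF less.prems(1) True r(1) less.prems(3)] by blast
      note c = bipartition_card[OF AB less.prems(1)]
      have sub: "A \<noteq> {}" "B \<noteq> {}" "p4_free r A" "p4_free r B"
        "biclique_free r p q A" "biclique_free r p q B" "card A < card V" "card B < card V"
        using AB c p4_free_subset[OF less.prems(3)] biclique_free_subset[OF less.prems(4)]
        by (auto simp: bipartition_def)
      show ?thesis
      proof (cases "\<forall>a\<in>A. \<forall>b\<in>B. r a b")
        case False
        then have sep: "\<forall>a\<in>A. \<forall>b\<in>B. \<not> r a b" using dich by blast
        have "int (degree_sum r A A) + 1 \<le> (int q + 2 * int p - 3) * int (card A)"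
          "int (degree_sum r B B) + 1 \<le> (int q + 2 * int p - 3) * int (card B)"
          using less.hyps[of A p q] less.hyps[of B p q] sub c p less.prems by simp_all
        with degree_sum_separated[OF AB less.prems(1) r(1) sep] c p show ?thesis
          by (simp add: algebra_simps)
      next
        case True
        have small: ?thesis if V: "bipartition V C D" and J: "\<forall>a\<in>C. \<forall>b\<in>D. r a b"
          and "card C < p" for C D
        proof -
          note d = bipartition_card[OF V less.prems(1)]
          have "biclique_free r (p - card C) q D"
            using biclique_free_join_rest[OF less.prems(4) V less.prems(1) J] that by simp
          moreover have "p4_free r D" "D \<noteq> {}"
            using V p4_free_subset[OF less.prems(3)] by (auto simp: bipartition_def)
          moreover have "1 \<le> p - card C" "p - card C \<le> q" "card D < card V"
            using that d less.prems by linarith+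
          ultimately have "int (degree_sum r D D) + (if 2 \<le> p - card C then 1 else 0)
              \<le> (int q + 2 * int (p - card C) - 3) * int (card D)"
            using less.hyps[of D "p - card C" q] d(2) by blast
          then have "int (degree_sum r D D)
              \<le> (int q + 2 * int (p - card C) - 3) * int (card D)"
            by (simp split: if_splits)
          from degree_sum_bound_join_small[OF r less.prems(1) V J \<open>card C < p\<close> less.prems(6) this] this d p
          show ?thesis by simp
        qed
        \<comment> \<open>Lowering the coefficient by \<open>card C\<close> saves
          \<open>card C * card D\<close>; over both sides this is exactly the degree sum between
          them.\<close>
        have large: "int (degree_sum r D D) + 1 \<le> (int q - int (card C) + 2 * int p - 3) * int (card D)"
          if V: "bipartition V C D" and J: "\<forall>a\<in>C. \<forall>b\<in>D. r a b"
          and "p \<le> card C" "p \<le> card D" for C D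
        proof -
          note d = bipartition_card[OF V less.prems(1)]
          have "\<forall>a\<in>D. \<forall>b\<in>C. r a b" using J r(1) by (auto dest: sympD)
          then have Cq: "card C < q"
            using biclique_free_join_sizes[OF less.prems(4) bipartition_sym[OF V]] that by simp
          have fD: "biclique_free r (q - card C) p D"
            using biclique_free_join_rest[OF biclique_free_sym[OF r(1) less.prems(4)] V less.prems(1) J Cq] .
          have D: "p4_free r D" "D \<noteq> {}" "card D < card V"
            using V p4_free_subset[OF less.prems(3)] d by (auto simp: bipartition_def)
          show ?thesis
          proof (cases "p \<le> q - card C")
            case True
            then show ?thesis
              using less.hyps[of D p "q - card C"] D d Cq p biclique_free_sym[OF r(1) fD]
              by (simp add: of_nat_diff algebra_simps)
          next
            \<comment> \<open>Now \<open>q - card C\<close> is the smaller parameter and takes over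
              the doubled role. The coefficient falls by at least one, which replaces the summand 1
              that the induction hypothesis grants only for parameters at least 2.\<close>
            case False
            then have "1 \<le> q - card C" "q - card C \<le> p" using Cq by linarith+
            then have "int (degree_sum r D D) + (if 2 \<le> q - card C then 1 else 0)
                \<le> (int p + 2 * int (q - card C) - 3) * int (card D)"
              using less.hyps[of D "q - card C" p] D d(2) fD by blast
            then have "int (degree_sum r D D) \<le> (int p + 2 * int (q - card C) - 3) * int (card D)"
              by (simp split: if_splits)
            also have "\<dots> \<le> (int q - int (card C) + 2 * int p - 3 - 1) * int (card D)"
              using False Cq by (intro mult_right_mono) (auto simp: of_nat_diff)
            also have "\<dots> \<le> (int q - int (card C) + 2 * int p - 3) * int (card D) - 1"
              using d by (simp add: algebra_simps)
            finally show ?thesis by simp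
          qed
        qed
        have True': "\<forall>a\<in>B. \<forall>b\<in>A. r a b" using True r(1) by (auto dest: sympD)
        consider "card A < p" | "card B < p" | "p \<le> card A" "p \<le> card B" by linarith
        then show ?thesis
        proof cases
          case 1
          with small[OF AB True] show ?thesis .
        next
          case 2
          with small[OF bipartition_sym[OF AB] True'] show ?thesis .
        next
          case 3
          from large[OF AB True 3] large[OF bipartition_sym[OF AB] True' 3(2,1)]
            degree_sum_join[OF AB less.prems(1) r(1) True] c p
          show ?thesis by (simp add: algebra_simps)
        qed
      qed
    qed
  qed
qed

text \<open>Induction along the same splits. The last hypothesis says that \<open>V\<close> has more
  than \<open>2 * t\<close> times its defect many vertices. It passes to one part of a disjoint
  union because defects add, and to the other side of a join because the defect falls by at least
  the size of the removed side, whose vertices become outside neighbours of the module.\<close>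

lemma regular_module_exists:
  assumes "symp r" "irreflp r" "finite V" "p4_free r V" "biclique_free r p t V" "1 \<le> p" "p \<le> t"
    and "2 * int t * ((int t + 2 * int p - 3) * int (card V) - int (degree_sum r V V)) < int (card V)"
  shows "\<exists>H N. H \<noteq> {} \<and> H \<subseteq> V \<and> card H \<le> 2 * t \<and> N \<subseteq> V - H \<and> card N = p - 1 \<and>
    (\<forall>h\<in>H. \<forall>w\<in>V - H. r h w \<longleftrightarrow> w \<in> N) \<and> (\<forall>h\<in>H. card {w \<in> H. r h w} = t - 1)"
  using assms(3-)
proof (induction "card V" arbitrary: V p rule: less_induct)
  case less
  note r = assms(1,2)
  \<comment> \<open>The defect, as a function of the parameter \<open>p\<close> that varies in the
    induction.\<close>
  define L where "L = (\<lambda>p W. (int t + 2 * int p - 3) * int (card W) - int (degree_sum r W W))"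
  have big: "2 * int t * L p V < int (card V)" using less.prems(6) by (simp add: L_def)
  have V0: "V \<noteq> {}"
    using less.prems(6) by (auto simp: degree_sum_def)
  have bound: "int (degree_sum r V V) + (if 2 \<le> p then 1 else 0) \<le> (int t + 2 * int p - 3) * int (card V)"
    using degree_sum_bound[OF r less.prems(1) V0 less.prems(2-5)] .
  have L0: "0 \<le> L p V" "2 \<le> p \<Longrightarrow> 1 \<le> L p V"
    using bound by (auto simp: L_def split: if_splits)
  show ?case
  proof (cases "card V \<le> 2 * t")
    case True
    \<comment> \<open>A defect of at least 1 would force more than \<open>2 * t\<close> vertices. So
      the defect is 0, and since it is positive for \<open>p \<ge> 2\<close>, only
      \<open>p = 1\<close> remains.\<close>
    have "L p V < 1"
    proof (rule ccontr)
      assume "\<not> L p V < 1"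
      then have "2 * int t * 1 \<le> 2 * int t * L p V" by (intro mult_left_mono) auto
      with big True show False by simp
    qed
    with L0 less.prems(4) have "p = 1" "L p V = 0" by fastforce+
    have le: "card {w \<in> V. r v w} \<le> t - 1" if "v \<in> V" for v
      using degree_le_of_star_free[of r t V v] less.prems that \<open>p = 1\<close> by simp
    have "int (degree_sum r V V) = int ((t - 1) * card V)"
      using \<open>L p V = 0\<close> \<open>p = 1\<close> less.prems(5) by (simp add: L_def of_nat_diff)
    then have "(\<Sum>v\<in>V. card {w \<in> V. r v w}) = (\<Sum>v\<in>V. t - 1)"
      by (simp only: of_nat_eq_iff) (simp add: degree_sum_def)
    \<comment> \<open>The degrees are at most \<open>t - 1\<close> and their sum attains this bound,
      so each of them does. Thus \<open>V\<close> itself is the module, with no outside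
      neighbours.\<close>
    then have "card {w \<in> V. r v w} = t - 1" if "v \<in> V" for v
      using sum_mono_inv[of "\<lambda>v. card {w \<in> V. r v w}" V "\<lambda>_. t - 1" v] le that less.prems(1) by blast
    then show ?thesis
      using V0 True \<open>p = 1\<close> by (intro exI[of _ V] exI[of _ "{}"]) auto
  next
    case False
    then have "2 \<le> card V" using less.prems by simp
    then obtain A B where AB: "bipartition V A B"
      and dich: "(\<forall>a\<in>A. \<forall>b\<in>B. r a b) \<or> (\<forall>a\<in>A. \<forall>b\<in>B. \<not> r a b)"
      using p4_free_split[OF less.prems(1) _ r(1) less.prems(2)] by blast
    note c = bipartition_card[OF AB less.prems(1)]
    show ?thesis
    proof (cases "\<forall>a\<in>A. \<forall>b\<in>B. r a b")
      case no: False
      then have sep: "\<forall>a\<in>A. \<forall>b\<in>B. \<not> r a b" using dich by blast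
      have step: ?thesis if V: "bipartition V C D" and S: "\<forall>a\<in>C. \<forall>b\<in>D. \<not> r a b"
        and b: "2 * int t * L p C < int (card C)" for C D
      proof -
        note d = bipartition_card[OF V less.prems(1)]
        have "C \<subseteq> V" using V by (auto simp: bipartition_def)
        then have "p4_free r C" "biclique_free r p t C"
          using p4_free_subset[OF less.prems(2)] biclique_free_subset[OF less.prems(3)] by simp_all
        then obtain H N where HN: "H \<noteq> {}" "H \<subseteq> C" "card H \<le> 2 * t" "N \<subseteq> C - H"
          "card N = p - 1" "\<forall>h\<in>H. \<forall>w\<in>C - H. r h w \<longleftrightarrow> w \<in> N"
          "\<forall>h\<in>H. card {w \<in> H. r h w} = t - 1"
          using less.hyps[of C p] d less.prems(4,5) b[unfolded L_def] by auto
        have V': "V = C \<union> D" "C \<inter> D = {}" using V by (auto simp: bipartition_def)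
        have "\<forall>h\<in>H. \<forall>w\<in>V - H. r h w \<longleftrightarrow> w \<in> N"
          using HN S V' by blast
        moreover have "H \<subseteq> V" "N \<subseteq> V - H" using HN V' by auto
        ultimately show ?thesis using HN by blast
      qed
      have "L p V = L p A + L p B"
        using degree_sum_separated[OF AB less.prems(1) r(1) sep] c by (simp add: L_def algebra_simps)
      then have "2 * int t * L p V = 2 * int t * L p A + 2 * int t * L p B"
        by (simp only: distrib_left)
      then have "2 * int t * L p A < int (card A) \<or> 2 * int t * L p B < int (card B)"
        using big c by linarith
      moreover have "\<forall>a\<in>B. \<forall>b\<in>A. \<not> r a b" using sep sympD[OF r(1)] by blast
      ultimately show ?thesis
        using step[OF AB sep] step[OF bipartition_sym[OF AB]] by blast
    next
      case True
      have True': "\<forall>a\<in>B. \<forall>b\<in>A. r a b" using True r(1) by (auto dest: sympD)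
      have step: ?thesis if V: "bipartition V C D" and J: "\<forall>a\<in>C. \<forall>b\<in>D. r a b"
        and Cp: "card C < p" for C D
      proof -
        note d = bipartition_card[OF V less.prems(1)]
        have fD: "biclique_free r (p - card C) t D"
          using biclique_free_join_rest[OF less.prems(3) V less.prems(1) J] that by simp
        have D: "p4_free r D" "D \<noteq> {}"
          using V p4_free_subset[OF less.prems(2)] by (auto simp: bipartition_def)
        have "int (degree_sum r D D) \<le> (int t + 2 * int (p - card C) - 3) * int (card D)"
        proof -
          have "1 \<le> p - card C" "p - card C \<le> t" using Cp less.prems by linarith+
          from degree_sum_bound[OF r d(2) D(2,1) fD this] show ?thesis
            by (simp split: if_splits)
        qed
        from degree_sum_bound_join_small[OF r less.prems(1) V J Cp less.prems(5) this]
        have "L (p - card C) D + int (card C) \<le> L p V" by (simp add: L_def)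
        then have "2 * int t * (L (p - card C) D + int (card C)) \<le> 2 * int t * L p V"
          by (intro mult_left_mono) auto
        then have "2 * int t * L (p - card C) D + 2 * int t * int (card C) \<le> 2 * int t * L p V"
          by (simp only: distrib_left)
        moreover have "1 * int (card C) \<le> 2 * int t * int (card C)"
          using less.prems by (intro mult_right_mono) auto
        moreover have "int (card V) = int (card C) + int (card D)" using d by simp
        ultimately have "2 * int t * L (p - card C) D < int (card D)"
          using big by linarith
        moreover have "1 \<le> p - card C" "p - card C \<le> t" "card D < card V"
          using d Cp less.prems(5) by linarith+
        ultimately obtain H N where HN: "H \<noteq> {}" "H \<subseteq> D" "card H \<le> 2 * t" "N \<subseteq> D - H"
          "card N = p - card C - 1" "\<forall>h\<in>H. \<forall>w\<in>D - H. r h w \<longleftrightarrow> w \<in> N"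
          "\<forall>h\<in>H. card {w \<in> H. r h w} = t - 1"
          using less.hyps[of D "p - card C"] d(2) D(1) fD unfolding L_def by blast
        have V': "V = C \<union> D" "C \<inter> D = {}" using V by (auto simp: bipartition_def)
        \<comment> \<open>\<open>C\<close> is completely joined to \<open>D\<close>, so all of
          \<open>C\<close> is added to the \<open>p - card C - 1\<close> outside neighbours found
          within \<open>D\<close>.\<close>
        have "\<forall>h\<in>H. \<forall>w\<in>V - H. r h w \<longleftrightarrow> w \<in> C \<union> N"
          using HN(2,6) J V' sympD[OF r(1)] by blast
        moreover have "H \<subseteq> V" "C \<union> N \<subseteq> V - H" using HN V' by auto
        moreover have "card (C \<union> N) = p - 1"
        proof -
          have "N \<subseteq> D" "finite N" using HN d by (auto intro: finite_subset)
          then show ?thesis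
            using HN(5) V' Cp d by (subst card_Un_disjoint) auto
        qed
        ultimately show ?thesis using HN(1,3,7) by blast
      qed
      consider "card A < p" | "card B < p" | "p \<le> card A" "p \<le> card B" by linarith
      then show ?thesis
      proof cases
        case 1
        with step[OF AB True] show ?thesis .
      next
        case 2
        with step[OF bipartition_sym[OF AB] True'] show ?thesis .
      next
        case 3
        \<comment> \<open>Two sides with fewer than \<open>t\<close> vertices each contradict
          \<open>card V > 2 * t\<close>; this explains the threshold \<open>2 * t\<close>.\<close>
        then have "card B < t" "card A < t"
          using biclique_free_join_sizes[OF less.prems(3) AB True]
            biclique_free_join_sizes[OF less.prems(3) bipartition_sym[OF AB] True'] by auto
        with False c show ?thesis by simp
      qed
    qed
  qed
qed

section \<open>Graphs and their adjacency relations\<close>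

abbreviation adj :: "'a ugraph \<Rightarrow> 'a \<Rightarrow> 'a \<Rightarrow> bool" where
  "adj G x y \<equiv> {x, y} \<in> edges G"

definition graph_of :: "'a set \<Rightarrow> ('a \<Rightarrow> 'a \<Rightarrow> bool) \<Rightarrow> 'a ugraph" where
  "graph_of V r = \<lparr>verts = V, edges = {{x, y} | x y. x \<in> V \<and> y \<in> V \<and> r x y}\<rparr>"

lemma verts_graph_of [simp]: "verts (graph_of V r) = V"
  by (simp add: graph_of_def)

lemma adj_graph_of: "symp r \<Longrightarrow> adj (graph_of V r) x y \<longleftrightarrow> x \<in> V \<and> y \<in> V \<and> r x y"
  by (auto simp: graph_of_def doubleton_eq_iff dest: sympD)

lemma simple_graph_graph_of: "finite V \<Longrightarrow> irreflp r \<Longrightarrow> simple_graph (graph_of V r)"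
  by (auto simp: graph_of_def simple_graph_def card_insert_if dest: irreflpD)

lemma symp_adj: "symp (adj G)"
  by (simp add: symp_def insert_commute)

lemma irreflp_adj: "simple_graph G \<Longrightarrow> irreflp (adj G)"
  by (auto simp: simple_graph_def irreflp_def)

lemma adj_vertsD: "simple_graph G \<Longrightarrow> adj G x y \<Longrightarrow> x \<in> verts G \<and> y \<in> verts G"
  by (auto simp: simple_graph_def)

lemma finite_edges: "simple_graph G \<Longrightarrow> finite (edges G)"
  unfolding simple_graph_def by (rule finite_subset[of _ "Pow (verts G)"]) auto

lemma edge_doubleton:
  assumes "simple_graph G" "e \<in> edges G"
  obtains x y where "e = {x, y}" "x \<noteq> y" "x \<in> verts G" "y \<in> verts G"
proof -
  have "card e = 2" "e \<subseteq> verts G" using assms by (auto simp: simple_graph_def)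
  then show ?thesis using that by (auto simp: card_2_iff)
qed

text \<open>Double counting of ordered adjacent pairs: each edge accounts for two.\<close>

lemma degree_sum_eq_edges:
  assumes "simple_graph G"
  shows "degree_sum (adj G) (verts G) (verts G) = 2 * card (edges G)"
proof -
  have fin: "finite (verts G)" using assms by (simp add: simple_graph_def)
  have two: "finite {(u, v). {u, v} = e} \<and> card {(u, v). {u, v} = e} = 2"
    if e_edge: "e \<in> edges G" for e
  proof -
    obtain x y where e: "e = {x, y}" "x \<noteq> y" using edge_doubleton[OF assms e_edge] by metis
    then have "{(u, v). {u, v} = e} = {(x, y), (y, x)}" by (auto simp: doubleton_eq_iff)
    then show ?thesis using e by simp
  qed
  have "degree_sum (adj G) (verts G) (verts G) = card (SIGMA u:verts G. {v \<in> verts G. adj G u v})"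
    unfolding degree_sum_def using fin by (subst card_SigmaI) auto
  also have "(SIGMA u:verts G. {v \<in> verts G. adj G u v}) = (\<Union>e\<in>edges G. {(u, v). {u, v} = e})"
    using adj_vertsD[OF assms] by auto
  also have "card \<dots> = (\<Sum>e\<in>edges G. card {(u, v). {u, v} = e})"
    using two finite_edges[OF assms] by (intro card_UN_disjoint) auto
  also have "\<dots> = 2 * card (edges G)" using two by simp
  finally show ?thesis .
qed

section \<open>Transfer along embeddings and isomorphisms\<close>

lemma p4_free_embed:
  assumes "p4_free r V" "inj_on g W" "g ` W \<subseteq> V"
    "\<And>x y. x \<in> W \<Longrightarrow> y \<in> W \<Longrightarrow> r' x y \<longleftrightarrow> r (g x) (g y)"
  shows "p4_free r' W"
proof (rule p4_freeI, goal_cases)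
  case (1 a b c d)
  have "distinct [g a, g b, g c, g d]"
    using 1(1-5) inj_onD[OF assms(2)] by auto
  moreover have "g a \<in> V" "g b \<in> V" "g c \<in> V" "g d \<in> V" using 1(1-4) assms(3) by auto
  ultimately show ?case
    using p4_freeD[OF assms(1), of "g a" "g b" "g c" "g d"] 1(1-4,6-) assms(4) by blast
qed

lemma biclique_free_embed:
  assumes "biclique_free r p q V" "inj_on g W" "g ` W \<subseteq> V"
    "\<And>x y. x \<in> W \<Longrightarrow> y \<in> W \<Longrightarrow> r' x y \<Longrightarrow> r (g x) (g y)"
  shows "biclique_free r' p q W"
proof (rule biclique_freeI, goal_cases)
  case (1 A B)
  have "card (g ` A) = p" "card (g ` B) = q"
    using 1 assms(2) by (auto simp: card_image inj_on_subset)
  moreover have "g ` A \<subseteq> V" "g ` B \<subseteq> V" using 1(1,2) assms(3) by blast+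
  moreover have "\<And>a b. a \<in> g ` A \<Longrightarrow> b \<in> g ` B \<Longrightarrow> r a b" using 1 assms(4) by blast
  ultimately show ?case using biclique_freeD[OF assms(1)] by blast
qed

lemma degree_sum_bij:
  assumes "bij_betw g W V" "\<And>x y. x \<in> W \<Longrightarrow> y \<in> W \<Longrightarrow> r' x y \<longleftrightarrow> r (g x) (g y)"
  shows "degree_sum r' W W = degree_sum r V V"
proof -
  have "card {y \<in> W. r' x y} = card {v \<in> V. r (g x) v}" if "x \<in> W" for x
  proof -
    have "{v \<in> V. r (g x) v} = g ` {y \<in> W. r' x y}"
      using assms that by (auto simp: bij_betw_def)
    moreover have "inj_on g {y \<in> W. r' x y}"
      using assms(1) by (auto simp: bij_betw_def inj_on_def)
    ultimately show ?thesis by (simp add: card_image)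
  qed
  then have "degree_sum r' W W = (\<Sum>x\<in>W. card {v \<in> V. r (g x) v})"
    by (simp add: degree_sum_def)
  also have "\<dots> = degree_sum r V V"
    unfolding degree_sum_def using assms(1) by (rule sum.reindex_bij_betw)
  finally show ?thesis .
qed

text \<open>The bijection runs from the second graph to the first, so that for a fixed pattern
  \<open>H\<close> it names the vertices of the copy.\<close>

lemma isomorphic_iff:
  assumes G: "simple_graph G" and H: "simple_graph H"
  shows "isomorphic G H \<longleftrightarrow>
    (\<exists>g. bij_betw g (verts H) (verts G) \<and>
      (\<forall>x\<in>verts H. \<forall>y\<in>verts H. adj H x y \<longleftrightarrow> adj G (g x) (g y)))"
proof
  assume "isomorphic G H"
  then obtain f where f: "bij_betw f (verts G) (verts H)" "edges H = (\<lambda>e. f ` e) ` edges G"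
    by (auto simp: isomorphic_def)
  define g where "g = inv_into (verts G) f"
  have g: "bij_betw g (verts H) (verts G)" unfolding g_def using f(1) by (rule bij_betw_inv_into)
  have fg: "f (g x) = x" "g x \<in> verts G" if "x \<in> verts H" for x
    using f(1) that bij_betw_apply[OF g] by (auto simp: g_def bij_betw_def f_inv_into_f)
  have "adj H x y \<longleftrightarrow> adj G (g x) (g y)" if xy: "x \<in> verts H" "y \<in> verts H" for x y
  proof
    assume "adj G (g x) (g y)"
    then have "f ` {g x, g y} \<in> edges H" using f(2) by blast
    then show "adj H x y" using fg xy by simp
  next
    assume "adj H x y"
    then obtain e where e: "e \<in> edges G" "f ` e = {x, y}" using f(2) by auto
    have "e \<subseteq> verts G" using e G by (auto simp: simple_graph_def)
    moreover have "f ` e = f ` {g x, g y}" "{g x, g y} \<subseteq> verts G" using e fg xy by auto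
    \<comment> \<open>Edges lie in the vertex set, where \<open>f\<close> is injective, so an edge
      is recovered from its image.\<close>
    ultimately have "e = {g x, g y}"
      using f(1) inj_on_image_eq_iff[of f "verts G" e "{g x, g y}"] by (simp add: bij_betw_def)
    then show "adj G (g x) (g y)" using e by simp
  qed
  with g show "\<exists>g. bij_betw g (verts H) (verts G) \<and>
      (\<forall>x\<in>verts H. \<forall>y\<in>verts H. adj H x y \<longleftrightarrow> adj G (g x) (g y))" by blast
next
  assume "\<exists>g. bij_betw g (verts H) (verts G) \<and>
      (\<forall>x\<in>verts H. \<forall>y\<in>verts H. adj H x y \<longleftrightarrow> adj G (g x) (g y))"
  then obtain g where g: "bij_betw g (verts H) (verts G)"
    "\<And>x y. x \<in> verts H \<Longrightarrow> y \<in> verts H \<Longrightarrow> adj H x y \<longleftrightarrow> adj G (g x) (g y)" by blast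
  define f where "f = inv_into (verts H) g"
  have f: "bij_betw f (verts G) (verts H)" unfolding f_def using g(1) by (rule bij_betw_inv_into)
  have gf: "g (f x) = x" "f x \<in> verts H" if "x \<in> verts G" for x
    using g(1) that bij_betw_apply[OF f] by (auto simp: f_def bij_betw_def f_inv_into_f)
  have fg: "f (g x) = x" "g x \<in> verts G" if "x \<in> verts H" for x
    using g(1) that by (auto simp: f_def bij_betw_def)
  have "edges H = (\<lambda>e. f ` e) ` edges G"
  proof (intro equalityI subsetI)
    fix e assume e: "e \<in> edges H"
    then obtain x y where xy: "e = {x, y}" "x \<in> verts H" "y \<in> verts H"
      using edge_doubleton[OF H] by metis
    then have "{g x, g y} \<in> edges G" "e = f ` {g x, g y}" using g(2) e fg by auto
    then show "e \<in> (\<lambda>e. f ` e) ` edges G" by blast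
  next
    fix e assume "e \<in> (\<lambda>e. f ` e) ` edges G"
    then obtain e' where e': "e' \<in> edges G" "e = f ` e'" by blast
    then obtain x y where xy: "e' = {x, y}" "x \<in> verts G" "y \<in> verts G"
      using edge_doubleton[OF G] by metis
    then have "adj H (f x) (f y)" using g(2)[of "f x" "f y"] gf e' by simp
    then show "e \<in> edges H" using e' xy by simp
  qed
  with f show "isomorphic G H" by (auto simp: isomorphic_def)
qed

section \<open>The two forbidden graphs in relational form\<close>

lemma simple_graph_path_graph: "simple_graph (path_graph m)"
  by (auto simp: simple_graph_def path_graph_def)

lemma simple_graph_complete_bipartite: "simple_graph (complete_bipartite s t)"
  by (auto simp: simple_graph_def complete_bipartite_def)

lemma simple_graph_induced: "simple_graph G \<Longrightarrow> W \<subseteq> verts G \<Longrightarrow> simple_graph (induced G W)"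
  by (auto simp: simple_graph_def induced_def intro: finite_subset)

lemma contains_induced_path_iff:
  assumes G: "simple_graph G"
  shows "contains_induced G (path_graph 4) \<longleftrightarrow> \<not> p4_free (adj G) (verts G)"
proof -
  have V: "verts (path_graph 4) = {0, 1, 2, 3}" by (auto simp: path_graph_def)
  have E: "adj (path_graph 4) i j \<longleftrightarrow> j < 4 \<and> j = Suc i \<or> i < 4 \<and> i = Suc j" for i j
    by (auto simp: path_graph_def doubleton_eq_iff)
  show ?thesis
  proof
    assume "contains_induced G (path_graph 4)"
    then obtain W where W: "W \<subseteq> verts G" "isomorphic (induced G W) (path_graph 4)"
      by (auto simp: contains_induced_def)
    then obtain g where g: "bij_betw g (verts (path_graph 4)) W"
      "\<And>x y. x \<in> verts (path_graph 4) \<Longrightarrow> y \<in> verts (path_graph 4) \<Longrightarrow>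
        adj (path_graph 4) x y \<longleftrightarrow> adj (induced G W) (g x) (g y)"
      unfolding isomorphic_iff[OF simple_graph_induced[OF G W(1)] simple_graph_path_graph]
      by (auto simp: induced_def)
    have gW: "g i \<in> W" if "i \<in> {0, 1, 2, 3}" for i
      using g(1) that unfolding V by (auto simp: bij_betw_def)
    have adj: "adj G (g i) (g j) \<longleftrightarrow> j < 4 \<and> j = Suc i \<or> i < 4 \<and> i = Suc j"
      if "i \<in> {0, 1, 2, 3}" "j \<in> {0, 1, 2, 3}" for i j
      using g(2)[of i j] gW[OF that(1)] gW[OF that(2)] that unfolding V E by (simp add: induced_def)
    have "inj_on g {0, 1, 2, 3}" using g(1) V by (simp add: bij_betw_def)
    then have "distinct [g 0, g 1, g 2, g 3]" by (auto simp: inj_on_def)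
    moreover have "adj G (g 0) (g 1)" "adj G (g 1) (g 2)" "adj G (g 2) (g 3)"
      "\<not> adj G (g 0) (g 2)" "\<not> adj G (g 1) (g 3)" "\<not> adj G (g 0) (g 3)"
      by (simp_all add: adj)
    moreover have "g 0 \<in> verts G" "g 1 \<in> verts G" "g 2 \<in> verts G" "g 3 \<in> verts G"
      using gW W(1) by auto
    ultimately show "\<not> p4_free (adj G) (verts G)"
      using p4_freeD[of "adj G" "verts G" "g 0" "g 1" "g 2" "g 3"] by blast
  next
    assume "\<not> p4_free (adj G) (verts G)"
    then obtain a b c d where abcd: "a \<in> verts G" "b \<in> verts G" "c \<in> verts G" "d \<in> verts G"
      "distinct [a, b, c, d]" "adj G a b" "adj G b c" "adj G c d"
      "\<not> adj G a c" "\<not> adj G b d" "\<not> adj G a d"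
      by (auto simp: p4_free_def)
    define W where "W = {a, b, c, d}"
    define g where "g i = (if i = 0 then a else if i = 1 then b else if i = 2 then c else d)" for i :: nat
    have W: "W \<subseteq> verts G" using abcd by (simp add: W_def)
    have g: "g 0 = a" "g (Suc 0) = b" "g 2 = c" "g 3 = d" by (simp_all add: g_def)
    have "bij_betw g (verts (path_graph 4)) (verts (induced G W))"
      using abcd(5) unfolding V by (auto simp: bij_betw_def inj_on_def g induced_def W_def)
    moreover have ad: "\<not> adj G c a" "\<not> adj G d b" "\<not> adj G d a" "adj G b a" "adj G c b" "adj G d c"
      "\<not> adj G x x" for x
      using abcd irreflpD[OF irreflp_adj[OF G]] by (simp_all add: insert_commute)
    have "\<forall>x\<in>verts (path_graph 4). \<forall>y\<in>verts (path_graph 4).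
        adj (path_graph 4) x y \<longleftrightarrow> adj (induced G W) (g x) (g y)"
      using abcd ad unfolding V E by (simp add: g W_def induced_def)
    ultimately have "isomorphic (induced G W) (path_graph 4)"
      unfolding isomorphic_iff[OF simple_graph_induced[OF G W] simple_graph_path_graph] by blast
    with W show "contains_induced G (path_graph 4)" by (auto simp: contains_induced_def)
  qed
qed

text \<open>A biclique yields the subgraph that keeps only the edges between \<open>A\<close> and
  \<open>B\<close>. The sides are disjoint because adjacency is irreflexive, and finite because
  \<open>s\<close> and \<open>t\<close> are positive.\<close>

lemma contains_complete_bipartite_iff:
  assumes G: "simple_graph G" and "1 \<le> s" "1 \<le> t"
  shows "contains_graph G (complete_bipartite s t) \<longleftrightarrow> \<not> biclique_free (adj G) s t (verts G)"
proof -
  let ?K = "complete_bipartite s t"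
  have V: "verts ?K = {..<s} <+> {..<t}" by (simp add: complete_bipartite_def)
  have E: "adj ?K (Inl i) (Inr j) \<longleftrightarrow> i < s \<and> j < t" "adj ?K (Inr j) (Inl i) \<longleftrightarrow> i < s \<and> j < t"
    "\<not> adj ?K (Inl i) (Inl i')" "\<not> adj ?K (Inr j) (Inr j')" for i i' j j'
    by (auto simp: complete_bipartite_def doubleton_eq_iff)
  show ?thesis
  proof
    assume "contains_graph G ?K"
    then obtain H' where H': "subgraph H' G" "isomorphic H' ?K" by (auto simp: contains_graph_def)
    have sH: "simple_graph H'" using H' by (simp add: subgraph_def)
    obtain g where g: "bij_betw g (verts ?K) (verts H')"
      "\<And>x y. x \<in> verts ?K \<Longrightarrow> y \<in> verts ?K \<Longrightarrow> adj ?K x y \<longleftrightarrow> adj H' (g x) (g y)"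
      using H'(2) unfolding isomorphic_iff[OF sH simple_graph_complete_bipartite] by blast
    have inj: "inj_on g (verts ?K)" "g ` verts ?K \<subseteq> verts G"
      using g(1) H'(1) by (auto simp: bij_betw_def subgraph_def)
    let ?A = "(\<lambda>i. g (Inl i)) ` {..<s}" and ?B = "(\<lambda>j. g (Inr j)) ` {..<t}"
    have "inj_on (\<lambda>i. g (Inl i)) {..<s}" "inj_on (\<lambda>j. g (Inr j)) {..<t}"
      using inj(1) unfolding V by (auto simp: inj_on_def)
    then have "card ?A = s" "card ?B = t" by (simp_all add: card_image)
    moreover have "?A \<subseteq> verts G" "?B \<subseteq> verts G" using inj(2) unfolding V by auto
    moreover have "adj G a b" if ab: "a \<in> ?A" "b \<in> ?B" for a b
    proof -
      obtain i j where ij: "i < s" "j < t" "a = g (Inl i)" "b = g (Inr j)" using ab by auto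
      then have "adj H' a b" using g(2)[of "Inl i" "Inr j"] E(1) V by auto
      then show ?thesis using H'(1) by (auto simp: subgraph_def)
    qed
    ultimately show "\<not> biclique_free (adj G) s t (verts G)"
      using biclique_freeD[of "adj G" s t "verts G" ?A ?B] by blast
  next
    assume "\<not> biclique_free (adj G) s t (verts G)"
    then obtain A B where AB: "A \<subseteq> verts G" "B \<subseteq> verts G" "card A = s" "card B = t"
      "\<forall>a\<in>A. \<forall>b\<in>B. adj G a b" by (auto simp: biclique_free_def)
    have fin: "finite A" "finite B" using AB assms by (metis card.infinite not_one_le_zero)+
    have dis: "A \<inter> B = {}" using AB(5) irreflp_adj[OF G] by (auto dest: irreflpD)
    obtain h k where h: "bij_betw h {..<s} A" and k: "bij_betw k {..<t} B"
      using ex_bij_betw_nat_finite[OF fin(1)] ex_bij_betw_nat_finite[OF fin(2)] AB(3,4)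
      by (auto simp: atLeast0LessThan)
    define r where "r x y \<longleftrightarrow> (x \<in> A \<and> y \<in> B \<or> x \<in> B \<and> y \<in> A)" for x y
    define H' where "H' = graph_of (A \<union> B) r"
    define g where "g = case_sum h k"
    have r: "symp r" "irreflp r" using dis by (auto simp: r_def symp_def irreflp_def)
    have sH: "simple_graph H'"
      unfolding H'_def using fin r by (simp add: simple_graph_graph_of)
    have hk: "\<And>i. i < s \<Longrightarrow> h i \<in> A" "\<And>j. j < t \<Longrightarrow> k j \<in> B"
      using h k by (auto simp: bij_betw_def)
    have "edges H' \<subseteq> edges G"
    proof
      fix e assume "e \<in> edges H'"
      then obtain x y where "e = {x, y}" "r x y" by (auto simp: H'_def graph_of_def)
      then show "e \<in> edges G" using AB(5) by (auto simp: r_def insert_commute)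
    qed
    then have "subgraph H' G" using sH AB by (simp add: subgraph_def H'_def)
    moreover have "bij_betw g (verts ?K) (verts H')"
    proof -
      have "inj_on g (verts ?K)"
      proof (rule inj_onI)
        have "h i = h i' \<longleftrightarrow> i = i'" if "i < s" "i' < s" for i i'
          using h that by (auto simp: bij_betw_def inj_on_def)
        moreover have "k j = k j' \<longleftrightarrow> j = j'" if "j < t" "j' < t" for j j'
          using k that by (auto simp: bij_betw_def inj_on_def)
        moreover have "h i \<noteq> k j" "k j \<noteq> h i" if "i < s" "j < t" for i j
          using hk dis that by (metis IntI empty_iff)+
        moreover fix x y assume "x \<in> verts ?K" "y \<in> verts ?K" "g x = g y"
        ultimately show "x = y"
          unfolding V g_def by (cases x; cases y) auto
      qed
      moreover have "g ` verts ?K = verts H'"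
        using h k unfolding V g_def H'_def bij_betw_def by (auto simp: image_Un Plus_def image_image)
      ultimately show ?thesis by (simp add: bij_betw_def)
    qed
    moreover have "\<forall>x\<in>verts ?K. \<forall>y\<in>verts ?K. adj ?K x y \<longleftrightarrow> adj H' (g x) (g y)"
    proof -
      have "\<And>i. i < s \<Longrightarrow> h i \<notin> B" "\<And>j. j < t \<Longrightarrow> k j \<notin> A" using hk dis by blast+
      then show ?thesis
        using hk unfolding V H'_def adj_graph_of[OF r(1)] g_def r_def by (auto simp: E)
    qed
    ultimately show "contains_graph G ?K"
      using isomorphic_iff[OF sH simple_graph_complete_bipartite] unfolding contains_graph_def by blast
  qed
qed

section \<open>Pumping\<close>

text \<open>Projection of a pumped graph to the original, identifying all copies of
  \<open>H\<close>. On a vertex set meeting at most one copy it is injective and preserves adjacency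
  in both directions.\<close>

fun unpump :: "'a + 'a \<times> nat \<Rightarrow> 'a" where
  "unpump (Inl w) = w"
| "unpump (Inr (v, j)) = v"

lemma adj_pump:
  "adj (pump H G k) (Inl u) (Inl w) \<longleftrightarrow>
     u \<in> verts G - verts H \<and> w \<in> verts G - verts H \<and> adj G u w"
  "adj (pump H G k) (Inr (u, i)) (Inr (v, j)) \<longleftrightarrow> i = j \<and> i \<in> {1..k+1} \<and> adj H u v"
  "adj (pump H G k) (Inr (v, j)) (Inl w) \<longleftrightarrow>
     j \<in> {1..k+1} \<and> v \<in> verts H \<and> w \<in> verts G - verts H \<and> adj G v w"
  "adj (pump H G k) (Inl w) (Inr (v, j)) \<longleftrightarrow>
     j \<in> {1..k+1} \<and> v \<in> verts H \<and> w \<in> verts G - verts H \<and> adj G v w"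
  by (auto simp: pump_def doubleton_eq_iff insert_commute)

section \<open>Pumping a module \<open>H\<close> with outside neighbourhood \<open>N\<close>\<close>

context
  fixes G H :: "'a ugraph" and N :: "'a set"
  assumes G: "simple_graph G" and H_sub: "verts H \<subseteq> verts G" and H: "H = induced G (verts H)"
    and N: "N \<subseteq> verts G - verts H"
    and module: "\<And>h w. h \<in> verts H \<Longrightarrow> w \<in> verts G - verts H \<Longrightarrow> adj G h w \<longleftrightarrow> w \<in> N"
begin

lemma adj_H: "adj H u v \<longleftrightarrow> u \<in> verts H \<and> v \<in> verts H \<and> adj G u v"
proof -
  have "edges H = {e \<in> edges G. e \<subseteq> verts H}"
    using arg_cong[OF H, of edges] by (simp add: induced_def)
  then show ?thesis by auto
qed

lemma finite_parts: "finite (verts G)" "finite (verts H)" "finite N" "finite (verts G - verts H)"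
  using G H_sub N by (auto simp: simple_graph_def intro: finite_subset)

lemma simple_graph_pump: "simple_graph (pump H G k)"
proof -
  have e: "card e = 2 \<and> e \<subseteq> verts (pump H G k)" if "e \<in> edges (pump H G k)" for e
    using that adj_H irreflpD[OF irreflp_adj[OF G]]
    by (auto simp: pump_def card_insert_if)
  show ?thesis
    using e finite_parts by (auto simp: simple_graph_def pump_def)
qed

lemma verts_pump: "Inl w \<in> verts (pump H G k) \<longleftrightarrow> w \<in> verts G - verts H"
  "Inr (v, j) \<in> verts (pump H G k) \<longleftrightarrow> v \<in> verts H \<and> j \<in> {1..k+1}"
  by (auto simp: pump_def)

lemma card_verts_pump: "card (verts (pump H G k)) = card (verts G) + k * card (verts H)"
proof -
  have "card (verts (pump H G k)) = card (verts G - verts H) + (k + 1) * card (verts H)"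
    using finite_parts unfolding pump_def
    by (simp add: card_Plus[unfolded Plus_def] card_cartesian_product)
  moreover have "card (verts H) \<le> card (verts G)" using H_sub finite_parts by (simp add: card_mono)
  ultimately show ?thesis using H_sub finite_parts by (simp add: card_Diff_subset)
qed

text \<open>The last premise excludes pairs from different copies: these are never adjacent, while
  their projections may be.\<close>

lemma adj_pump_unpump:
  assumes "x \<in> verts (pump H G k)" "y \<in> verts (pump H G k)"
    and "\<And>u v i j. x = Inr (u, i) \<Longrightarrow> y = Inr (v, j) \<Longrightarrow> i = j"
  shows "adj (pump H G k) x y \<longleftrightarrow> adj G (unpump x) (unpump y)"
proof (cases x)
  case (Inl u)
  then show ?thesis
    using assms by (cases y) (auto simp: adj_pump verts_pump insert_commute)
next
  case (Inr p)
  then show ?thesis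
    using assms by (cases y; cases p) (auto simp: adj_pump verts_pump adj_H)
qed

lemma inj_on_unpump:
  assumes "W \<subseteq> verts (pump H G k)"
    and "\<And>u v i j. Inr (u, i) \<in> W \<Longrightarrow> Inr (v, j) \<in> W \<Longrightarrow> i = j"
  shows "inj_on unpump W"
proof (rule inj_onI)
  fix x y assume xy: "x \<in> W" "y \<in> W" "unpump x = unpump y"
  have v: "x \<in> verts (pump H G k)" "y \<in> verts (pump H G k)" using xy assms(1) by auto
  show "x = y"
  proof (cases x)
    case (Inl u)
    then show ?thesis using xy v by (cases y) (auto simp: verts_pump)
  next
    case (Inr p)
    then show ?thesis using xy v assms(2) by (cases y; cases p) (auto simp: verts_pump)
  qed
qed

lemma unpump_in_verts: "x \<in> verts (pump H G k) \<Longrightarrow> unpump x \<in> verts G"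
  using H_sub by (cases x) (auto simp: verts_pump)

text \<open>The copies of \<open>H\<close> form a homogeneous set, and a path on four vertices has no homogeneous set
  with two or three vertices; so an induced path meets at most one copy.\<close>

lemma p4_free_pump:
  assumes "p4_free (adj G) (verts G)"
  shows "p4_free (adj (pump H G k)) (verts (pump H G k))"
proof (rule p4_freeI)
  let ?V = "verts (pump H G k)" and ?r = "adj (pump H G k)"
  fix a b c d
  assume V: "a \<in> ?V" "b \<in> ?V" "c \<in> ?V" "d \<in> ?V" and dist: "distinct [a, b, c, d]"
    and path: "?r a b" "?r b c" "?r c d" "\<not> ?r a c" "\<not> ?r b d" "\<not> ?r a d"
  define W where "W = {a, b, c, d}"
  define M where "M x \<longleftrightarrow> (\<exists>p. x = Inr p)" for x :: "'a + 'a \<times> nat"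
  have sym: "?r y x \<longleftrightarrow> ?r x y" for x y by (simp add: insert_commute)
  have "?r x z \<longleftrightarrow> unpump z \<in> N" if "x \<in> ?V" "z \<in> ?V" "M x" "\<not> M z" for x z
    using that module by (cases z) (auto simp: M_def adj_pump verts_pump)
  then have homog: "?r x z \<longleftrightarrow> ?r y z"
    if "M x" "M y" "\<not> M z" "x \<in> ?V" "y \<in> ?V" "z \<in> ?V" for x y z
    using that by simp
  \<comment> \<open>For each pair of path vertices there is a third one adjacent to exactly one of
    the two; homogeneity forces it into \<open>M\<close>. Repeating this reaches all four
    vertices.\<close>
  have "M a \<Longrightarrow> M b \<Longrightarrow> M c" "M a \<Longrightarrow> M c \<Longrightarrow> M d" "M a \<Longrightarrow> M d \<Longrightarrow> M b" "M b \<Longrightarrow> M c \<Longrightarrow> M a"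
    "M b \<Longrightarrow> M d \<Longrightarrow> M a" "M c \<Longrightarrow> M d \<Longrightarrow> M b"
    using homog[of a b c] homog[of a c d] homog[of a d b] homog[of b c a] homog[of b d a]
      homog[of c d b] V path sym[of b a] sym[of c a] sym[of d a] sym[of c b] sym[of d b] by blast+
  then have few: "M a \<and> M b \<and> M c \<and> M d \<or> x = y"
    if "x \<in> W" "y \<in> W" "M x" "M y" for x y
    using that unfolding W_def by blast
  \<comment> \<open>Adjacent vertices of copies share their copy, so a path lying entirely in copies
    stays in one.\<close>
  have copies: "snd p = snd q" if "?r (Inr p) (Inr q)" for p q
    using that by (cases p; cases q) (simp add: adj_pump)
  have same: "i = j" if uv: "Inr (u, i) \<in> W" "Inr (v, j) \<in> W" for u v i j
  proof (cases "M a \<and> M b \<and> M c \<and> M d")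
    case True
    then obtain p q p' q' where e: "a = Inr p" "b = Inr q" "c = Inr p'" "d = Inr q'"
      by (auto simp: M_def)
    then have "snd p = snd q" "snd q = snd p'" "snd p' = snd q'" using copies path(1-3) by blast+
    then show ?thesis using uv unfolding W_def e by auto
  next
    case False
    then show ?thesis using few[OF uv] by (auto simp: M_def)
  qed
  have "p4_free ?r W"
  proof (rule p4_free_embed[OF assms])
    show "inj_on unpump W" using inj_on_unpump[of W k] same V by (auto simp: W_def)
    show "unpump ` W \<subseteq> verts G" using unpump_in_verts V by (auto simp: W_def)
    fix x y assume "x \<in> W" "y \<in> W"
    then show "?r x y \<longleftrightarrow> adj G (unpump x) (unpump y)"
      using adj_pump_unpump[of x k y] same V by (auto simp: W_def)
  qed
  then show False using p4_freeD[of ?r W a b c d] dist path by (auto simp: W_def)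
qed

text \<open>Vertices from different copies are not adjacent, so they cannot lie on opposite sides of
  a biclique; their common neighbours lie in \<open>N\<close>, which has fewer than \<open>s\<close>
  elements, so they cannot lie on the same side. A biclique therefore meets at most one copy and
  projects into \<open>G\<close>.\<close>

lemma biclique_free_pump:
  assumes "biclique_free (adj G) s t (verts G)" "card N < s" "s \<le> t"
  shows "biclique_free (adj (pump H G k)) s t (verts (pump H G k))"
proof (rule biclique_freeI)
  let ?V = "verts (pump H G k)" and ?r = "adj (pump H G k)"
  fix A B
  assume AB: "A \<subseteq> ?V" "B \<subseteq> ?V" "card A = s" "card B = t"
    and r: "\<And>a b. a \<in> A \<Longrightarrow> b \<in> B \<Longrightarrow> ?r a b"
  have few: "card X < s"
    if i: "i \<noteq> j" and X: "X \<subseteq> ?V" "\<And>x. x \<in> X \<Longrightarrow> ?r (Inr (u, i)) x \<and> ?r (Inr (v, j)) x"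
    for u v i j X
  proof -
    have "X \<subseteq> Inl ` N"
    proof
      fix x assume "x \<in> X"
      then have x: "x \<in> ?V" "?r (Inr (u, i)) x" "?r (Inr (v, j)) x" using X by auto
      show "x \<in> Inl ` N"
      proof (cases x)
        case (Inl w)
        then show ?thesis using x module by (auto simp: adj_pump)
      next
        case (Inr p)
        then show ?thesis using x i by (cases p) (auto simp: adj_pump)
      qed
    qed
    then have "card X \<le> card N"
      using finite_parts(3) by (metis card_image card_mono finite_imageI inj_Inl)
    then show ?thesis using assms(2) by simp
  qed
  have r': "?r b a" if "a \<in> A" "b \<in> B" for a b
    using r[OF that] by (simp add: insert_commute)
  have same: "i = j" if W: "Inr (u, i) \<in> A \<union> B" "Inr (v, j) \<in> A \<union> B" for u v i j
  proof (rule ccontr)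
    assume ij: "i \<noteq> j"
    consider "Inr (u, i) \<in> A" "Inr (v, j) \<in> A" | "Inr (u, i) \<in> B" "Inr (v, j) \<in> B"
      | "Inr (u, i) \<in> A" "Inr (v, j) \<in> B" | "Inr (u, i) \<in> B" "Inr (v, j) \<in> A" using W by blast
    then show False
    proof cases
      case 1
      then show False using few[OF ij AB(2), of u v] r AB assms(3) by auto
    next
      case 2
      then show False using few[OF ij AB(1), of u v] r' AB assms(3) by auto
    next
      case 3
      then show False using r[OF 3] ij by (simp add: adj_pump)
    next
      case 4
      then show False using r'[OF 4(2,1)] ij by (simp add: adj_pump)
    qed
  qed
  have "biclique_free ?r s t (A \<union> B)"
  proof (rule biclique_free_embed[OF assms(1)])
    show "inj_on unpump (A \<union> B)" using inj_on_unpump[of "A \<union> B" k] same AB by auto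
    show "unpump ` (A \<union> B) \<subseteq> verts G" using unpump_in_verts AB by blast
    fix x y assume "x \<in> A \<union> B" "y \<in> A \<union> B" "?r x y"
    then show "adj G (unpump x) (unpump y)"
      using adj_pump_unpump[of x k y] same AB by blast
  qed
  then show False
    using biclique_freeD[of ?r s t "A \<union> B" A B] AB r by blast
qed

text \<open>Outside vertices and copies are summed separately. Pairs between \<open>N\<close> and
  the copies are counted from both ends, hence the factor 2.\<close>

lemma degree_sum_pump:
  "degree_sum (adj (pump H G k)) (verts (pump H G k)) (verts (pump H G k)) =
    degree_sum (adj G) (verts G - verts H) (verts G - verts H)
    + (k + 1) * (degree_sum (adj H) (verts H) (verts H) + 2 * card (verts H) * card N)"
proof -
  let ?V = "verts (pump H G k)" and ?r = "adj (pump H G k)" and ?O = "verts G - verts H"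
  have V: "?V = Inl ` ?O \<union> Inr ` (verts H \<times> {1..k+1})" by (simp add: pump_def)
  have "card {y \<in> ?V. ?r (Inl w) y} =
      card {y \<in> ?O. adj G w y} + (if w \<in> N then (k + 1) * card (verts H) else 0)"
    if w: "w \<in> ?O" for w
  proof -
    have "{y \<in> ?V. ?r (Inl w) y} =
        Inl ` {y \<in> ?O. adj G w y} \<union> Inr ` (if w \<in> N then verts H \<times> {1..k+1} else {})"
      using w module by (auto simp: V adj_pump)
    then show ?thesis
      using finite_parts
      by (simp add: card_Plus[unfolded Plus_def] card_cartesian_product)
  qed
  then have outer: "(\<Sum>w\<in>?O. card {y \<in> ?V. ?r (Inl w) y}) =
      degree_sum (adj G) ?O ?O + (k + 1) * card (verts H) * card N"
    using finite_parts N
    by (simp add: degree_sum_def sum.distrib sum.If_cases Int_absorb1 Collect_conj_eq)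
  have "card {y \<in> ?V. ?r (Inr p) y} = card {y \<in> verts H. adj H (fst p) y} + card N"
    if p: "p \<in> verts H \<times> {1..k+1}" for p
  proof -
    obtain v j where v: "p = (v, j)" "v \<in> verts H" "j \<in> {1..k+1}" using p by auto
    have "{y \<in> ?V. ?r (Inr p) y} = Inl ` N \<union> Inr ` ((\<lambda>y. (y, j)) ` {y \<in> verts H. adj H v y})"
      using v module N by (auto simp: V adj_pump)
    then show ?thesis
      using finite_parts v by (simp add: card_Plus[unfolded Plus_def] card_image inj_on_def)
  qed
  then have "(\<Sum>p\<in>verts H \<times> {1..k+1}. card {y \<in> ?V. ?r (Inr p) y}) =
      (\<Sum>p\<in>verts H \<times> {1..k+1}. card {y \<in> verts H. adj H (fst p) y} + card N)"
    by simp
  also have "\<dots> = (\<Sum>v\<in>verts H. \<Sum>j\<in>{1..k+1}. card {y \<in> verts H. adj H v y} + card N)"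
    unfolding sum.cartesian_product by (intro sum.cong) auto
  also have "\<dots> = (k + 1) * (degree_sum (adj H) (verts H) (verts H) + card (verts H) * card N)"
    by (simp add: degree_sum_def sum.distrib sum_distrib_left algebra_simps)
  finally have inner: "(\<Sum>p\<in>verts H \<times> {1..k+1}. card {y \<in> ?V. ?r (Inr p) y}) =
      (k + 1) * (degree_sum (adj H) (verts H) (verts H) + card (verts H) * card N)" .
  have "degree_sum ?r ?V ?V = (\<Sum>x\<in>Inl ` ?O. card {y \<in> ?V. ?r x y})
      + (\<Sum>x\<in>Inr ` (verts H \<times> {1..k+1}). card {y \<in> ?V. ?r x y})"
    unfolding degree_sum_def V[symmetric]
    using finite_parts by (subst V, subst sum.union_disjoint) auto
  also have "\<dots> = (\<Sum>w\<in>?O. card {y \<in> ?V. ?r (Inl w) y})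
      + (\<Sum>p\<in>verts H \<times> {1..k+1}. card {y \<in> ?V. ?r (Inr p) y})"
    by (simp add: sum.reindex)
  finally show ?thesis unfolding outer inner by (simp add: algebra_simps)
qed

lemma degree_sum_pump_0:
  "degree_sum (adj (pump H G 0)) (verts (pump H G 0)) (verts (pump H G 0)) =
    degree_sum (adj G) (verts G) (verts G)"
proof (rule degree_sum_bij)
  have same: "i = j" if "Inr (u, i) \<in> verts (pump H G 0)" "Inr (v, j) \<in> verts (pump H G 0)" for u v i j
    using that by (simp add: verts_pump)
  have "unpump ` verts (pump H G 0) = verts G"
    using H_sub by (force simp: pump_def image_Un image_image)
  then show "bij_betw unpump (verts (pump H G 0)) (verts G)"
    using inj_on_unpump[of "verts (pump H G 0)" 0] same by (auto simp: bij_betw_def)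
  fix x y assume "x \<in> verts (pump H G 0)" "y \<in> verts (pump H G 0)"
  then show "adj (pump H G 0) x y \<longleftrightarrow> adj G (unpump x) (unpump y)"
    using adj_pump_unpump[of x 0 y] same by blast
qed

text \<open>Comparison with zero pumpings eliminates the outside term. For \<open>d = t - 1\<close>
  and \<open>card N = s - 1\<close> the gain per added vertex is exactly the coefficient of the
  linear bound.\<close>

lemma degree_sum_pump_regular:
  assumes "regular d H"
  shows "degree_sum (adj (pump H G k)) (verts (pump H G k)) (verts (pump H G k)) =
    degree_sum (adj G) (verts G) (verts G) + k * card (verts H) * (d + 2 * card N)"
proof -
  have "degree_sum (adj H) (verts H) (verts H) = card (verts H) * d"
    using assms by (simp add: degree_sum_def regular_def neighbours_def)
  then show ?thesis
    using degree_sum_pump[of k] degree_sum_pump[of 0] degree_sum_pump_0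
    by (simp add: algebra_simps)
qed

lemma is_component_H: "verts H \<noteq> {} \<Longrightarrow> is_component H G"
proof -
  have "neighbours G u - verts H = N" if "u \<in> verts H" for u
    using that module N by (auto simp: neighbours_def)
  then show "verts H \<noteq> {} \<Longrightarrow> is_component H G"
    using H H_sub by (simp add: is_component_def)
qed

lemma common_outside_neighbours_H: "verts H \<noteq> {} \<Longrightarrow> common_outside_neighbours H G = N"
  using module N by (auto simp: common_outside_neighbours_def neighbours_def)

end

section \<open>Extremal numbers\<close>

text \<open>Pumping changes the vertex type, whereas \<open>ex_cograph\<close> ranges over graphs on
  \<open>nat\<close>. A copy along an enumeration of \<open>V\<close> makes such graphs
  competitors.\<close>

lemma nat_model:
  fixes r :: "'a \<Rightarrow> 'a \<Rightarrow> bool"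
  assumes "symp r" "irreflp r" "finite V" "p4_free r V" "biclique_free r s t V"
  obtains G :: "nat ugraph" where "simple_graph G" "card (verts G) = card V"
    "p4_free (adj G) (verts G)" "biclique_free (adj G) s t (verts G)"
    "2 * card (edges G) = degree_sum r V V"
proof -
  obtain h where h: "bij_betw h {..<card V} V"
    using ex_bij_betw_nat_finite[OF assms(3)] by (auto simp: atLeast0LessThan)
  define r' where "r' i j \<longleftrightarrow> r (h i) (h j)" for i j
  define G where "G = graph_of {..<card V} r'"
  have r': "symp r'" "irreflp r'"
    using assms(1,2) by (auto simp: r'_def symp_def irreflp_def)
  have G: "simple_graph G" by (simp add: G_def simple_graph_graph_of r')
  have V: "verts G = {..<card V}" by (simp add: G_def)
  have adj: "adj G i j \<longleftrightarrow> r (h i) (h j)" if "i \<in> {..<card V}" "j \<in> {..<card V}" for i j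
    using that unfolding G_def adj_graph_of[OF r'(1)] r'_def by blast
  have inj: "inj_on h {..<card V}" "h ` {..<card V} \<subseteq> V" using h by (auto simp: bij_betw_def)
  show ?thesis
  proof (rule that[OF G])
    show "card (verts G) = card V" by (simp add: V)
    show "p4_free (adj G) (verts G)" unfolding V by (rule p4_free_embed[OF assms(4) inj adj])
    show "biclique_free (adj G) s t (verts G)" unfolding V
      by (rule biclique_free_embed[OF assms(5) inj]) (use adj in blast)
    show "2 * card (edges G) = degree_sum r V V"
      unfolding degree_sum_eq_edges[OF G, symmetric] V by (rule degree_sum_bij[OF h]) (use adj in blast)
  qed
qed

text \<open>Every vertex of a path has a neighbour, so isolated vertices outside \<open>V\<close>
  never lie on one.\<close>

lemma p4_free_isolated:
  assumes "p4_free r V" "\<And>x y. r x y \<Longrightarrow> x \<in> V \<and> y \<in> V"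
  shows "p4_free r W"
proof (rule p4_freeI)
  fix a b c d assume "distinct [a, b, c, d]" "r a b" "r b c" "r c d" "\<not> r a c" "\<not> r b d" "\<not> r a d"
  then show False using p4_freeD[OF assms(1), of a b c d] assms(2) by blast
qed

lemma biclique_free_isolated:
  assumes "biclique_free r p q V" "\<And>x y. r x y \<Longrightarrow> x \<in> V \<and> y \<in> V" "1 \<le> p" "1 \<le> q"
  shows "biclique_free r p q W"
proof (rule biclique_freeI)
  fix A B assume AB: "card A = p" "card B = q" "\<And>a b. a \<in> A \<Longrightarrow> b \<in> B \<Longrightarrow> r a b"
  then have "A \<noteq> {}" "B \<noteq> {}" using assms(3,4) by auto
  then have "A \<subseteq> V" "B \<subseteq> V" using AB(3) assms(2) by blast+
  then show False using biclique_freeD[OF assms(1)] AB by blast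
qed

lemma degree_sum_isolated:
  assumes "finite W" "V \<subseteq> W" "\<And>x y. r x y \<Longrightarrow> x \<in> V \<and> y \<in> V"
  shows "degree_sum r W W = degree_sum r V V"
proof -
  have "{y \<in> W. r x y} = {y \<in> V. r x y}" for x using assms by blast
  moreover have "card {y \<in> V. r x y} = 0" if "x \<in> W - V" for x
  proof -
    have "{y \<in> V. r x y} = {}" using that assms(3) by blast
    then show ?thesis by (simp only: card.empty)
  qed
  ultimately show ?thesis
    unfolding degree_sum_def using assms(1,2) by (intro sum.mono_neutral_cong_right) auto
qed

section \<open>Extremal graphs and their defect for fixed \<open>s\<close> and
  \<open>t\<close>\<close>

context
  fixes s t :: nat
  assumes s: "2 \<le> s" and st: "s \<le> t"
begin

definition feasible :: "nat ugraph \<Rightarrow> nat \<Rightarrow> bool" where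
  "feasible G n \<longleftrightarrow> simple_graph G \<and> card (verts G) = n \<and>
     p4_free (adj G) (verts G) \<and> biclique_free (adj G) s t (verts G)"

lemma ex_cograph_eq: "ex_cograph n s t = Max {card (edges G) | G. feasible G n}"
proof -
  have "(simple_graph G \<and> card (verts G) = n \<and> \<not> contains_graph G (complete_bipartite s t)
      \<and> \<not> contains_induced G (path_graph 4)) \<longleftrightarrow> feasible G n" for G :: "nat ugraph"
    using contains_complete_bipartite_iff[of G s t] contains_induced_path_iff[of G] s st
    unfolding feasible_def by auto
  then show ?thesis by (simp add: ex_cograph_def)
qed

lemma feasible_exists: "\<exists>G. feasible G n"
proof -
  let ?G = "graph_of {..<n} (\<lambda>_ _. False)"
  have adj: "\<not> adj ?G x y" for x y by (simp add: graph_of_def)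
  have "simple_graph ?G" by (rule simple_graph_graph_of) (simp_all add: irreflp_def)
  moreover have "biclique_free (adj ?G) s t (verts ?G)"
  proof (rule biclique_freeI)
    fix A B assume "card A = s" "card B = t" "\<And>a b. a \<in> A \<Longrightarrow> b \<in> B \<Longrightarrow> adj ?G a b"
    moreover from this have "A \<noteq> {}" "B \<noteq> {}" using s st by auto
    ultimately show False using adj by blast
  qed
  moreover have "p4_free (adj ?G) (verts ?G)" by (rule p4_freeI) (use adj in blast)
  ultimately have "feasible ?G n" by (simp add: feasible_def)
  then show ?thesis ..
qed

lemma finite_feasible: "finite {card (edges G) | G. feasible G n}"
proof (rule finite_subset)
  show "{card (edges G) | G. feasible G n} \<subseteq> {..n * n}"
  proof
    fix m assume "m \<in> {card (edges G) | G. feasible G n}"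
    then obtain G where G: "feasible G n" and m: "m = card (edges G)" by blast
    then have "2 * card (edges G) \<le> card (verts G) * (card (verts G) - 1)"
      using degree_sum_le_complete[of "verts G" "adj G"] degree_sum_eq_edges[of G] irreflp_adj[of G]
      by (auto simp: feasible_def simple_graph_def)
    also have "\<dots> \<le> n * n" using G by (auto simp: feasible_def intro!: mult_mono)
    finally show "m \<in> {..n * n}" by (simp add: m)
  qed
qed simp

lemma ex_cograph_attained: "\<exists>G. feasible G n \<and> card (edges G) = ex_cograph n s t"
proof -
  have "ex_cograph n s t \<in> {card (edges G) | G. feasible G n}"
    unfolding ex_cograph_eq using finite_feasible feasible_exists by (intro Max_in) auto
  then show ?thesis by auto
qed

lemma degree_sum_le_ex_cograph:
  assumes "symp r" "irreflp r" "finite V" "p4_free r V" "biclique_free r s t V"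
  shows "degree_sum r V V \<le> 2 * ex_cograph (card V) s t"
proof -
  obtain G :: "nat ugraph" where "feasible G (card V)" "2 * card (edges G) = degree_sum r V V"
    using nat_model[OF assms] unfolding feasible_def by metis
  moreover from this have "card (edges G) \<le> ex_cograph (card V) s t"
    unfolding ex_cograph_eq using finite_feasible by (intro Max_ge) auto
  ultimately show ?thesis by simp
qed

text \<open>\<open>G\<close> may have any vertex type, but by its copy on \<open>nat\<close> it
  cannot exceed the maximum; extremality thus means attaining it.\<close>

lemma extremal_cograph_iff:
  fixes G :: "'a ugraph"
  assumes "simple_graph G"
  shows "extremal_cograph s t G \<longleftrightarrow> p4_free (adj G) (verts G) \<and> biclique_free (adj G) s t (verts G) \<and>
    degree_sum (adj G) (verts G) (verts G) = 2 * ex_cograph (card (verts G)) s t"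
proof -
  let ?n = "card (verts G)"
  have feas: "(cograph G' \<and> \<not> contains_graph G' (complete_bipartite s t) \<and> card (verts G') = ?n)
      \<longleftrightarrow> feasible G' ?n" for G' :: "nat ugraph"
    using contains_complete_bipartite_iff[of G' s t] contains_induced_path_iff[of G'] s st
    unfolding feasible_def cograph_def by auto
  have G: "(cograph G \<and> \<not> contains_graph G (complete_bipartite s t)) \<longleftrightarrow>
      p4_free (adj G) (verts G) \<and> biclique_free (adj G) s t (verts G)"
    using contains_complete_bipartite_iff[of G s t] contains_induced_path_iff[of G] s st assms
    unfolding cograph_def by auto
  have fin: "finite (verts G)" using assms by (simp add: simple_graph_def)
  have max: "(\<forall>G'. feasible G' ?n \<longrightarrow> card (edges G') \<le> card (edges G))
      \<longleftrightarrow> ex_cograph ?n s t \<le> card (edges G)"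
    unfolding ex_cograph_eq using finite_feasible feasible_exists by (subst Max_le_iff) auto
  have le: "card (edges G) \<le> ex_cograph ?n s t"
    if "p4_free (adj G) (verts G)" "biclique_free (adj G) s t (verts G)"
    using degree_sum_le_ex_cograph[OF symp_adj irreflp_adj[OF assms] fin that]
    by (simp add: degree_sum_eq_edges[OF assms])
  have "extremal_cograph s t G \<longleftrightarrow> (cograph G \<and> \<not> contains_graph G (complete_bipartite s t)) \<and>
      (\<forall>G'. feasible G' ?n \<longrightarrow> card (edges G') \<le> card (edges G))"
    unfolding extremal_cograph_def using feas by blast
  then show ?thesis
    unfolding G max degree_sum_eq_edges[OF assms] using le by auto
qed

text \<open>Twice the gap in the linear upper bound, so that it is an integer.\<close>

definition defect :: "nat \<Rightarrow> int" where
  "defect n = (int t + 2 * int s - 3) * int n - 2 * int (ex_cograph n s t)"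

lemma defect_le:
  assumes "symp r" "irreflp r" "finite V" "p4_free r V" "biclique_free r s t V"
  shows "defect (card V) \<le> (int t + 2 * int s - 3) * int (card V) - int (degree_sum r V V)"
  using degree_sum_le_ex_cograph[OF assms] by (simp add: defect_def)

lemma defect_pos:
  assumes "1 \<le> n"
  shows "1 \<le> defect n"
proof -
  obtain G where G: "feasible G n" "card (edges G) = ex_cograph n s t"
    using ex_cograph_attained by blast
  then have "finite (verts G)" "verts G \<noteq> {}" using assms
    by (auto simp: feasible_def simple_graph_def)
  with degree_sum_bound[of "adj G" "verts G" s t] G s st show ?thesis
    by (simp add: defect_def feasible_def symp_adj irreflp_adj degree_sum_eq_edges)
qed

lemma ex_cograph_eq_defect:
  "real (ex_cograph n s t) = - real_of_int (defect n) / 2 + ((real t - 1) / 2 + real s - 1) * real n"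
  by (simp add: defect_def field_simps)

section \<open>Core graphs and the existence of extremal ones\<close>

definition core :: "nat ugraph \<Rightarrow> nat ugraph \<Rightarrow> nat set \<Rightarrow> bool" where
  "core G H N \<longleftrightarrow> simple_graph G \<and> p4_free (adj G) (verts G) \<and> biclique_free (adj G) s t (verts G) \<and>
     verts H \<noteq> {} \<and> verts H \<subseteq> verts G \<and> H = induced G (verts H) \<and> regular (t - 1) H \<and>
     N \<subseteq> verts G - verts H \<and> card N = s - 1 \<and>
     (\<forall>h\<in>verts H. \<forall>w\<in>verts G - verts H. adj G h w \<longleftrightarrow> w \<in> N)"

text \<open>Every added vertex raises the degree sum by \<open>t - 1 + 2 * (s - 1)\<close>, which is
  the coefficient \<open>t + 2 * s - 3\<close>, so the defect is unchanged. The biclique condition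
  survives because \<open>N\<close> has only \<open>s - 1\<close> elements.\<close>

lemma pump_core:
  assumes "core G H N"
  shows "simple_graph (pump H G k)"
    and "p4_free (adj (pump H G k)) (verts (pump H G k))"
    and "biclique_free (adj (pump H G k)) s t (verts (pump H G k))"
    and "card (verts (pump H G k)) = card (verts G) + k * card (verts H)"
    and "(int t + 2 * int s - 3) * int (card (verts (pump H G k)))
        - int (degree_sum (adj (pump H G k)) (verts (pump H G k)) (verts (pump H G k)))
      = (int t + 2 * int s - 3) * int (card (verts G)) - int (degree_sum (adj G) (verts G) (verts G))"
    and "is_component H G"
    and "common_outside_neighbours H G = N"
proof -
  have c: "simple_graph G" "verts H \<subseteq> verts G" "H = induced G (verts H)" "N \<subseteq> verts G - verts H"
    "\<And>h w. h \<in> verts H \<Longrightarrow> w \<in> verts G - verts H \<Longrightarrow> adj G h w \<longleftrightarrow> w \<in> N"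
    and c': "card N = s - 1" "regular (t - 1) H" "verts H \<noteq> {}"
    using assms by (auto simp: core_def)
  show "simple_graph (pump H G k)" by (rule simple_graph_pump[OF c])
  show "p4_free (adj (pump H G k)) (verts (pump H G k))"
    using p4_free_pump[OF c] assms by (simp add: core_def)
  show "biclique_free (adj (pump H G k)) s t (verts (pump H G k))"
    using biclique_free_pump[OF c] assms s st by (simp add: core_def)
  show n: "card (verts (pump H G k)) = card (verts G) + k * card (verts H)"
    by (rule card_verts_pump[OF c])
  define d where "d = t - 1 + 2 * card N"
  have K: "int t + 2 * int s - 3 = int d" using c'(1) s st by (simp add: d_def)
  have ds: "degree_sum (adj (pump H G k)) (verts (pump H G k)) (verts (pump H G k)) =
      degree_sum (adj G) (verts G) (verts G) + k * card (verts H) * d"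
    unfolding d_def by (rule degree_sum_pump_regular[OF c c'(2)])
  show "(int t + 2 * int s - 3) * int (card (verts (pump H G k)))
        - int (degree_sum (adj (pump H G k)) (verts (pump H G k)) (verts (pump H G k)))
      = (int t + 2 * int s - 3) * int (card (verts G)) - int (degree_sum (adj G) (verts G) (verts G))"
    unfolding K n ds by (simp add: algebra_simps)
  show "is_component H G" by (rule is_component_H[OF c c'(3)])
  show "common_outside_neighbours H G = N" by (rule common_outside_neighbours_H[OF c c'(3)])
qed

text \<open>The complete graph on \<open>s + t - 1\<close> vertices is too small for the biclique.
  Its first \<open>t\<close> vertices form the module, the other \<open>s - 1\<close> the outside
  neighbours.\<close>

lemma complete_graph_core: "\<exists>G H N. core G H N \<and> card (verts G) = s + t - 1 \<and> card (verts H) = t"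
proof -
  define G where "G = graph_of {..<s + t - 1} (\<lambda>x y :: nat. x \<noteq> y)"
  define H where "H = induced G {..<t}"
  have neq: "symp (\<lambda>x y :: nat. x \<noteq> y)" "irreflp (\<lambda>x y :: nat. x \<noteq> y)"
    by (auto simp: symp_def irreflp_def)
  have V: "verts G = {..<s + t - 1}" "verts H = {..<t}" by (simp_all add: G_def H_def induced_def)
  have adj: "adj G x y \<longleftrightarrow> x < s + t - 1 \<and> y < s + t - 1 \<and> x \<noteq> y" for x y
    unfolding G_def adj_graph_of[OF neq(1)] by simp
  have G: "simple_graph G" unfolding G_def by (rule simple_graph_graph_of[OF _ neq(2)]) simp
  have "p4_free (adj G) (verts G)"
    by (rule p4_freeI) (auto simp: adj)
  moreover have "biclique_free (adj G) s t (verts G)"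
  proof (rule biclique_freeI)
    fix A B assume AB: "A \<subseteq> verts G" "B \<subseteq> verts G" "card A = s" "card B = t"
      "\<And>a b. a \<in> A \<Longrightarrow> b \<in> B \<Longrightarrow> adj G a b"
    then have "finite A" "finite B" "A \<inter> B = {}" by (auto simp: V adj intro: finite_subset)
    then have "card (A \<union> B) = s + t" using AB by (simp add: card_Un_disjoint)
    moreover have "card (A \<union> B) \<le> card (verts G)" using AB V by (intro card_mono) auto
    ultimately show False using V s by simp
  qed
  moreover have "regular (t - 1) H"
    unfolding regular_def
  proof
    fix v assume v: "v \<in> verts H"
    have "neighbours H v = {..<t} - {v}"
      using v s adj[of v v] by (auto simp: neighbours_def V adj) (auto simp: H_def induced_def adj)
    then show "card (neighbours H v) = t - 1" using v V by simp
  qed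
  moreover have "H = induced G (verts H)" by (simp add: H_def induced_def)
  moreover have "{..<t} \<noteq> {}" "{..<t} \<subseteq> {..<s + t - 1}" "{t..<s + t - 1} \<subseteq> {..<s + t - 1} - {..<t}"
    "\<forall>h\<in>{..<t}. \<forall>w\<in>{..<s + t - 1} - {..<t}. adj G h w \<longleftrightarrow> w \<in> {t..<s + t - 1}"
    using s st unfolding adj by (auto simp: lessThan_empty_iff)
  ultimately have "core G H {t..<s + t - 1}"
    using G unfolding core_def V by (intro conjI) simp_all
  then show ?thesis using V by (intro exI[of _ G] exI[of _ H] exI[of _ "{t..<s + t - 1}"]) simp
qed

text \<open>The complete core is pumped as often as \<open>n\<close> permits, and fewer than
  \<open>t\<close> isolated vertices fill the rest. Pumping costs nothing and an isolated vertex
  costs the coefficient, so the bound is independent of \<open>n\<close>.\<close>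

lemma defect_bounded: "\<exists>C\<ge>0. \<forall>n\<ge>s + t - 1. defect n \<le> C"
proof -
  obtain G H N where c: "core G H N" "card (verts G) = s + t - 1" "card (verts H) = t"
    using complete_graph_core by blast
  define K where "K = int t + 2 * int s - 3"
  \<comment> \<open>The first term bounds the defect of the pumped graph, which is that of the
    complete core; the second allows for up to \<open>t\<close> isolated vertices.\<close>
  define C where "C = K * int (s + t - 1) + K * int t"
  have K: "0 \<le> K" using s st by (simp add: K_def)
  have "defect n \<le> C" if n: "s + t - 1 \<le> n" for n
  proof -
    define k where "k = (n - (s + t - 1)) div t"
    define P where "P = pump H G k"
    have simple: "simple_graph P" and P4: "p4_free (adj P) (verts P)"
      and bf: "biclique_free (adj P) s t (verts P)"
      and cP: "card (verts P) = s + t - 1 + k * t"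
      using pump_core(1-5)[OF c(1), of k] c(2,3) by (simp_all add: P_def)
    have D: "K * int (card (verts P)) - int (degree_sum (adj P) (verts P) (verts P))
        \<le> K * int (s + t - 1)"
      using pump_core(5)[OF c(1), of k] c(2) unfolding K_def P_def by simp
    have "k * t \<le> n - (s + t - 1)" "n - (s + t - 1) < k * t + t"
      using s st div_mult_mod_eq[of "n - (s + t - 1)" t] mod_less_divisor[of t "n - (s + t - 1)"]
      unfolding k_def by linarith+
    with n cP have sz: "card (verts P) \<le> n" "n \<le> card (verts P) + t" by linarith+
    have fin: "finite (verts P)" using simple by (simp add: simple_graph_def)
    obtain W where W: "verts P \<subseteq> W" "finite W" "card W = n"
    proof -
      have "infinite (UNIV - verts P)"
        using fin by (intro Diff_infinite_finite) (simp_all add: infinite_UNIV_char_0 finite_Plus_UNIV_iff flip: UNIV_Plus_UNIV)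
      then obtain X where X: "X \<subseteq> UNIV - verts P" "finite X" "card X = n - card (verts P)"
        using infinite_arbitrarily_large by metis
      then have "card (verts P \<union> X) = n"
        using fin sz by (subst card_Un_disjoint) auto
      with X fin show ?thesis by (intro that[of "verts P \<union> X"]) auto
    qed
    note iso = adj_vertsD[OF simple]
    have "defect n \<le> K * int n - int (degree_sum (adj P) W W)"
      using defect_le[OF symp_adj irreflp_adj[OF simple] W(2)
          p4_free_isolated[OF P4 iso] biclique_free_isolated[OF bf iso]] s st W(3)
      by (simp add: K_def)
    also have "\<dots> = K * int n - int (degree_sum (adj P) (verts P) (verts P))"
      using degree_sum_isolated[OF W(2,1) iso] by simp
    also have "\<dots> \<le> K * (int (card (verts P)) + int t) - int (degree_sum (adj P) (verts P) (verts P))"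
      using sz K by (intro diff_right_mono mult_left_mono) auto
    also have "\<dots> \<le> C" using D by (simp add: C_def distrib_left)
    finally show ?thesis .
  qed
  moreover have "0 \<le> C" using K by (simp add: C_def)
  ultimately show ?thesis by blast
qed

text \<open>Extremal graphs have bounded defect. Once \<open>n\<close> exceeds \<open>2 * t\<close>
  times the bound, an extremal graph contains a regular module and is itself a core.\<close>

lemma core_exists:
  "\<exists>n0\<ge>1. \<forall>n\<ge>n0. \<exists>G H N. core G H N \<and> card (verts G) = n \<and> card (verts H) \<le> 2 * t \<and>
     degree_sum (adj G) (verts G) (verts G) = 2 * ex_cograph n s t"
proof -
  obtain C where C: "0 \<le> C" "\<And>n. s + t - 1 \<le> n \<Longrightarrow> defect n \<le> C" using defect_bounded by blast
  define n0 where "n0 = s + t + nat (2 * int t * C)"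
  have "\<exists>G H N. core G H N \<and> card (verts G) = n \<and> card (verts H) \<le> 2 * t \<and>
     degree_sum (adj G) (verts G) (verts G) = 2 * ex_cograph n s t" if n: "n0 \<le> n" for n
  proof -
    obtain G where G: "feasible G n" "card (edges G) = ex_cograph n s t"
      using ex_cograph_attained by blast
    have simple: "simple_graph G" and V: "card (verts G) = n" "finite (verts G)"
      and P4: "p4_free (adj G) (verts G)" and bf: "biclique_free (adj G) s t (verts G)"
      using G by (auto simp: feasible_def simple_graph_def)
    have ds: "degree_sum (adj G) (verts G) (verts G) = 2 * ex_cograph n s t"
      using degree_sum_eq_edges[OF simple] G by simp
    have "2 * int t * defect n \<le> 2 * int t * C"
      using C(2)[of n] n by (intro mult_left_mono) (auto simp: n0_def)
    also have "\<dots> < int n"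
      using n s C(1) unfolding n0_def by linarith
    finally have "2 * int t * ((int t + 2 * int s - 3) * int (card (verts G))
        - int (degree_sum (adj G) (verts G) (verts G))) < int (card (verts G))"
      unfolding V ds by (simp add: defect_def)
    from regular_module_exists[OF symp_adj irreflp_adj[OF simple] V(2) P4 bf _ st this] s
    obtain W N where W: "W \<noteq> {}" "W \<subseteq> verts G" "card W \<le> 2 * t" "N \<subseteq> verts G - W" "card N = s - 1"
      "\<forall>h\<in>W. \<forall>w\<in>verts G - W. adj G h w \<longleftrightarrow> w \<in> N" "\<forall>h\<in>W. card {w \<in> W. adj G h w} = t - 1"
      by auto
    have "regular (t - 1) (induced G W)"
      unfolding regular_def
    proof
      fix v assume v: "v \<in> verts (induced G W)"
      then have "neighbours (induced G W) v = {w \<in> W. adj G v w}"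
        by (auto simp: neighbours_def induced_def)
      then show "card (neighbours (induced G W) v) = t - 1" using W(7) v by (simp add: induced_def)
    qed
    moreover have "verts (induced G W) = W" by (simp add: induced_def)
    ultimately have "core G (induced G W) N"
      using simple P4 bf W unfolding core_def by simp
    then show ?thesis using V ds W(3)
      by (intro exI[of _ G] exI[of _ "induced G W"] exI[of _ N]) (simp add: induced_def)
  qed
  moreover have "1 \<le> n0" using s by (simp add: n0_def)
  ultimately show ?thesis by blast
qed

text \<open>The pumped graph still has defect \<open>defect n\<close>. If it were disconnected, one
  of two separated parts would have at least \<open>n0\<close> vertices, since
  \<open>2 * n0 \<le> n\<close>, hence a defect of at least \<open>defect n\<close> by minimality,
  and the other part would add at least 1.\<close>

lemma pump_core_connected:
  assumes c: "core G H N" and n: "card (verts G) = n" "2 * n0 \<le> n" "1 \<le> n0"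
    and ds: "degree_sum (adj G) (verts G) (verts G) = 2 * ex_cograph n s t"
    and min: "\<And>m. n0 \<le> m \<Longrightarrow> defect n \<le> defect m"
  shows "graph_connected (pump H G k)"
proof (rule ccontr)
  define P where "P = pump H G k"
  have simple: "simple_graph P" and P4: "p4_free (adj P) (verts P)"
    and bf: "biclique_free (adj P) s t (verts P)" and cP: "n \<le> card (verts P)"
    using pump_core(1-5)[OF c, of k] n by (simp_all add: P_def)
  define L where "L W = (int t + 2 * int s - 3) * int (card W) - int (degree_sum (adj P) W W)" for W
  have LP: "L (verts P) = defect n"
    using pump_core(5)[OF c, of k] n(1) ds unfolding P_def L_def defect_def by simp
  have fin: "finite (verts P)" using simple by (simp add: simple_graph_def)
  assume "\<not> graph_connected (pump H G k)"
  moreover have "verts P \<noteq> {}" using cP n by auto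
  ultimately obtain u v where uv: "u \<in> verts P" "v \<in> verts P" "(u, v) \<notin> {(x, y). adj P x y}\<^sup>*"
    by (auto simp: graph_connected_def P_def)
  define A where "A = {x \<in> verts P. (u, x) \<in> {(x, y). adj P x y}\<^sup>*}"
  have AB: "bipartition (verts P) A (verts P - A)"
    using uv by (auto simp: bipartition_def A_def)
  have sep: "\<forall>a\<in>A. \<forall>b\<in>verts P - A. \<not> adj P a b"
    by (auto simp: A_def intro: rtrancl_into_rtrancl)
  have sub: "p4_free (adj P) W" "biclique_free (adj P) s t W" "finite W" if "W \<subseteq> verts P" for W
    using p4_free_subset[OF P4 that] biclique_free_subset[OF bf that] finite_subset[OF that fin] by auto
  have small: "1 \<le> L W" if "W \<subseteq> verts P" "W \<noteq> {}" for W
    using degree_sum_bound[OF symp_adj irreflp_adj[OF simple] sub(3)[OF that(1)] that(2)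
        sub(1,2)[OF that(1)]] s st
    by (simp add: L_def)
  have large: "defect n \<le> L W" if "W \<subseteq> verts P" "n0 \<le> card W" for W
    using defect_le[OF symp_adj irreflp_adj[OF simple] sub(3,1,2)[OF that(1)]] min[OF that(2)]
    by (simp add: L_def)
  have ne: "A \<noteq> {}" "verts P - A \<noteq> {}" "A \<subseteq> verts P" "verts P - A \<subseteq> verts P"
    using AB by (auto simp: bipartition_def)
  have cards: "card (verts P) = card A + card (verts P - A)"
    using bipartition_card[OF AB fin] by simp
  then have "L (verts P) = L A + L (verts P - A)"
    using degree_sum_separated[OF AB fin symp_adj sep] by (simp add: L_def algebra_simps)
  moreover have "n0 \<le> card A \<or> n0 \<le> card (verts P - A)" using cards cP n(2) by linarith
  ultimately show False
    using LP small[OF ne(3,1)] small[OF ne(4,2)] large[OF ne(3)] large[OF ne(4)] by linarith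
qed

section \<open>Eventual periodicity of the defect\<close>

lemma card_core_dvd_fact:
  assumes "core G H N" "card (verts H) \<le> 2 * t"
  shows "card (verts H) dvd fact (2 * t)"
proof -
  have "finite (verts H)" "verts H \<noteq> {}"
    using assms(1) by (auto simp: core_def simple_graph_def intro: finite_subset)
  then show ?thesis
    using assms(2) by (intro dvd_fact) (auto simp: Suc_le_eq card_gt_0_iff)
qed

text \<open>The factorial is a multiple of every module size, so an extremal core on
  \<open>n\<close> vertices can be pumped to gain exactly \<open>k * fact (2 * t)\<close> vertices.
  The result competes at the larger order with the same defect.\<close>

lemma defect_step:
  assumes "\<forall>n\<ge>n0. \<exists>G H N. core G H N \<and> card (verts G) = n \<and> card (verts H) \<le> 2 * t \<and>
     degree_sum (adj G) (verts G) (verts G) = 2 * ex_cograph n s t" and "n0 \<le> n"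
  shows "defect (n + k * fact (2 * t)) \<le> defect n"
proof -
  obtain G H N where c: "core G H N" "card (verts G) = n" "card (verts H) \<le> 2 * t"
    "degree_sum (adj G) (verts G) (verts G) = 2 * ex_cograph n s t" using assms by blast
  obtain m where m: "fact (2 * t) = card (verts H) * m"
    using card_core_dvd_fact[OF c(1,3)] by (auto simp: dvd_def)
  note p = pump_core(1-5)[OF c(1), of "k * m"]
  have "card (verts (pump H G (k * m))) = n + k * fact (2 * t)"
    using p(4) c(2) m by (simp add: mult_ac)
  moreover have "finite (verts (pump H G (k * m)))" using p(1) by (simp add: simple_graph_def)
  ultimately show ?thesis
    using defect_le[OF symp_adj irreflp_adj[OF p(1)] _ p(2,3)] p(5) c(2,4) by (simp add: defect_def)
qed

lemma extremal_pump_core: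
  assumes "core G H N" "degree_sum (adj G) (verts G) (verts G) = 2 * ex_cograph (card (verts G)) s t"
    and "defect (card (verts (pump H G k))) = defect (card (verts G))"
  shows "extremal_cograph s t (pump H G k)"
  using pump_core(1-3,5)[OF assms(1), of k] assms(2,3)
  by (simp add: extremal_cograph_iff defect_def)

text \<open>A minimiser exists because defects of positive orders are positive integers. Adding
  multiples of \<open>R\<close> does not increase the defect, so the minimiser can be moved beyond
  \<open>2 * n0\<close>, as the connectedness argument requires.\<close>

lemma defect_argmin:
  assumes "\<And>n k. n0 \<le> n \<Longrightarrow> defect (n + k * R) \<le> defect n" "j < R" "1 \<le> n0"
  shows "\<exists>n\<ge>2 * n0. n mod R = j \<and> (\<forall>m\<ge>n0. m mod R = j \<longrightarrow> defect n \<le> defect m)"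
proof -
  \<comment> \<open>\<open>j + n0 * R\<close> witnesses that the class has a member that is at least
    \<open>n0\<close>.\<close>
  have "n0 * 1 \<le> n0 * R" using assms(2) by (intro mult_le_mono2) simp
  moreover have "(j + n0 * R) mod R = j" using assms(2) by simp
  ultimately have "n0 \<le> j + n0 * R \<and> (j + n0 * R) mod R = j" by linarith
  from ex_has_least_nat[of "\<lambda>m. n0 \<le> m \<and> m mod R = j", OF this, of "\<lambda>m. nat (defect m)"]
  obtain m where m: "n0 \<le> m" "m mod R = j"
    "\<And>m'. n0 \<le> m' \<Longrightarrow> m' mod R = j \<Longrightarrow> nat (defect m) \<le> nat (defect m')" by blast
  have min: "defect m \<le> defect m'" if "n0 \<le> m'" "m' mod R = j" for m'
    using m(3)[OF that] defect_pos[of m'] that assms(3) by (simp add: nat_le_eq_zle)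
  have "2 * n0 * 1 \<le> 2 * n0 * R" using assms(2) by (intro mult_le_mono2) simp
  then have "2 * n0 \<le> m + 2 * n0 * R" by linarith
  moreover have "(m + 2 * n0 * R) mod R = j" using m(2) by simp
  moreover have "\<forall>m'\<ge>n0. m' mod R = j \<longrightarrow> defect (m + 2 * n0 * R) \<le> defect m'"
  proof (intro allI impI)
    fix m' assume "n0 \<le> m'" "m' mod R = j"
    then show "defect (m + 2 * n0 * R) \<le> defect m'"
      using min[of m'] assms(1)[OF m(1), of "2 * n0"] by linarith
  qed
  ultimately show ?thesis by blast
qed

end

section \<open>One core for each residue class\<close>

theorem theorem1:
  fixes s t :: nat
  assumes "2 \<le> s" and "s \<le> t"
  shows "(\<exists>(N :: nat) (R :: nat) (G :: nat \<Rightarrow> nat ugraph) (H :: nat \<Rightarrow> nat ugraph).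
           1 \<le> N \<and> 1 \<le> R \<and>
           (\<forall>j<R. simple_graph (G j) \<and> card (verts (G j)) \<le> N \<and>
                  is_component (H j) (G j) \<and> regular (t - 1) (H j) \<and>
                  card (common_outside_neighbours (H j) (G j)) = s - 1) \<and>
           (\<forall>\<^sub>F n in sequentially.
              \<exists>k. card (verts (pump (H (n mod R)) (G (n mod R)) k)) = n \<and>
                  extremal_cograph s t (pump (H (n mod R)) (G (n mod R)) k)) \<and>
           (\<exists>a :: nat \<Rightarrow> real. (\<forall>j<R. a j < 0) \<and>
              (\<forall>\<^sub>F n in sequentially.
                 real (ex_cograph n s t) =
                   a (n mod R) + ((real t - 1) / 2 + real s - 1) * real n)) \<and>
           (\<exists>q<R. \<forall>k. extremal_cograph s t (pump (H q) (G q) k) \<longrightarrow>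
                      graph_connected (pump (H q) (G q) k)))
       \<and> (\<forall>n\<ge>1. real (ex_cograph n s t) < ((real t - 1) / 2 + real s - 1) * real n)"
proof -
  define D where "D = defect s t"
  note st = assms
  have pos: "1 \<le> D n" if "1 \<le> n" for n using defect_pos[OF st that] by (simp add: D_def)
  have ex: "real (ex_cograph n s t) = - real_of_int (D n) / 2 + ((real t - 1) / 2 + real s - 1) * real n" for n
    unfolding D_def by (rule ex_cograph_eq_defect[OF st])
  obtain n0 where n0: "1 \<le> n0" and cores: "\<forall>n\<ge>n0. \<exists>G H N. core s t G H N \<and> card (verts G) = n \<and>
      card (verts H) \<le> 2 * t \<and> degree_sum (adj G) (verts G) (verts G) = 2 * ex_cograph n s t"
    using core_exists[OF st] by blast
  \<comment> \<open>A common multiple of all module sizes, which are at most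
    \<open>2 * t\<close>.\<close>
  define R :: nat where "R = fact (2 * t)"
  have R: "1 \<le> R" by (simp add: R_def Suc_le_eq)
  have step: "D (n + k * R) \<le> D n" if "n0 \<le> n" for n k
    using defect_step[OF st cores that] by (simp add: D_def R_def)
  have "\<exists>n\<ge>2 * n0. n mod R = j \<and> (\<forall>m\<ge>n0. m mod R = j \<longrightarrow> D n \<le> D m)" if "j < R" for j
    using defect_argmin[OF st, of n0 R j] step that n0 unfolding D_def by blast
  \<comment> \<open>\<open>f j\<close> will be the order of the core for class \<open>j\<close>; it
    minimises the defect over the members of the class from \<open>n0\<close> on.\<close>
  then obtain f where f: "\<And>j. j < R \<Longrightarrow> 2 * n0 \<le> f j \<and> f j mod R = j \<and>
      (\<forall>m\<ge>n0. m mod R = j \<longrightarrow> D (f j) \<le> D m)" by metis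
  have "\<exists>G H N. core s t G H N \<and> card (verts G) = f j \<and> card (verts H) \<le> 2 * t \<and>
      degree_sum (adj G) (verts G) (verts G) = 2 * ex_cograph (f j) s t" if "j < R" for j
    using cores f[OF that] by simp
  then obtain G H N where GHN: "\<And>j. j < R \<Longrightarrow> core s t (G j) (H j) (N j) \<and> card (verts (G j)) = f j \<and>
      card (verts (H j)) \<le> 2 * t \<and>
      degree_sum (adj (G j)) (verts (G j)) (verts (G j)) = 2 * ex_cograph (f j) s t" by metis
  have le_sum: "f j \<le> (\<Sum>j<R. f j)" if "j < R" for j
    using that by (intro member_le_sum) auto
  \<comment> \<open>The sum dominates every \<open>f j\<close>, so \<open>n = f j + l * R\<close>
    for \<open>j = n mod R\<close>. Pumping gives \<open>D n \<le> D (f j)\<close>, and the choice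
    of \<open>f j\<close> gives the converse.\<close>
  have const: "D n = D (f (n mod R))" and pumped: "\<exists>k. card (verts (pump (H (n mod R)) (G (n mod R)) k)) = n \<and>
      extremal_cograph s t (pump (H (n mod R)) (G (n mod R)) k)" if n: "(\<Sum>j<R. f j) \<le> n" for n
  proof -
    define j where "j = n mod R"
    have j: "j < R" using R by (simp add: j_def)
    have "f j \<le> n" using le_sum[OF j] n by simp
    moreover have "f j mod R = n mod R" using f[OF j] by (simp add: j_def)
    ultimately have "R dvd n - f j" by (metis mod_eq_dvd_iff_nat)
    then obtain l where "n - f j = R * l" by (auto simp: dvd_def)
    with \<open>f j \<le> n\<close> have l: "n = f j + l * R" by (simp add: mult.commute)
    have "n0 \<le> f j" using f[OF j] by simp
    then have "D n = D (f j)"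
      using step[of "f j" l] f[OF j] j_def l by (metis antisym trans_le_add1)
    then show "D n = D (f (n mod R))" by (simp add: j_def)
    note c = GHN[OF j]
    \<comment> \<open>\<open>m\<close> pumpings add exactly \<open>R\<close> vertices, so
      \<open>l * m\<close> of them lead from order \<open>f j\<close> to order
      \<open>n\<close>.\<close>
    obtain m where m: "R = card (verts (H j)) * m"
      using card_core_dvd_fact[OF st] c by (metis R_def dvdE)
    have "card (verts (pump (H j) (G j) (l * m))) = n"
      using pump_core(4)[OF st, of "G j" "H j" "N j" "l * m"] c l m by (simp add: mult_ac)
    moreover from this have "extremal_cograph s t (pump (H j) (G j) (l * m))"
      using extremal_pump_core[OF st, of "G j" "H j" "N j" "l * m"] c \<open>D n = D (f j)\<close>
      by (simp add: D_def)
    ultimately show "\<exists>k. card (verts (pump (H (n mod R)) (G (n mod R)) k)) = n \<and>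
      extremal_cograph s t (pump (H (n mod R)) (G (n mod R)) k)" unfolding j_def by blast
  qed
  \<comment> \<open>The class with the smallest minimal defect: its core is then minimal over all
    orders from \<open>n0\<close> on, which forces connectedness.\<close>
  obtain q where q: "q < R" "\<And>j. j < R \<Longrightarrow> nat (D (f q)) \<le> nat (D (f j))"
    using ex_has_least_nat[of "\<lambda>j. j < R" 0 "\<lambda>j. nat (D (f j))"] R by auto
  have fpos: "1 \<le> D (f j)" if "j < R" for j
    using pos[of "f j"] f[OF that] n0 by simp
  have min: "D (f q) \<le> D m" if "n0 \<le> m" for m
  proof -
    have "m mod R < R" using R by simp
    then have "D (f q) \<le> D (f (m mod R))" "D (f (m mod R)) \<le> D m"
      using q(2)[of "m mod R"] fpos[of "m mod R"] f[of "m mod R"] that by (simp_all add: nat_le_eq_zle)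
    then show ?thesis by simp
  qed
  have "graph_connected (pump (H q) (G q) k)" for k
    using pump_core_connected[OF st, of "G q" "H q" "N q" "f q" n0 k] GHN[OF q(1)] f[OF q(1)] n0 min
    by (simp add: D_def)
  moreover have "simple_graph (G j) \<and> card (verts (G j)) \<le> (\<Sum>j<R. f j) + 1 \<and>
      is_component (H j) (G j) \<and> regular (t - 1) (H j) \<and>
      card (common_outside_neighbours (H j) (G j)) = s - 1" if "j < R" for j
  proof -
    have c: "core s t (G j) (H j) (N j)" using GHN[OF that] by blast
    from pump_core(6,7)[OF st c] c GHN[OF that] le_sum[OF that] show ?thesis
      by (simp add: core_def[OF st])
  qed
  moreover have "\<forall>\<^sub>F n in sequentially. \<exists>k. card (verts (pump (H (n mod R)) (G (n mod R)) k)) = n \<and>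
      extremal_cograph s t (pump (H (n mod R)) (G (n mod R)) k)"
    unfolding eventually_sequentially using pumped by blast
  moreover have "\<exists>a :: nat \<Rightarrow> real. (\<forall>j<R. a j < 0) \<and> (\<forall>\<^sub>F n in sequentially.
      real (ex_cograph n s t) = a (n mod R) + ((real t - 1) / 2 + real s - 1) * real n)"
  \<comment> \<open>The defect is twice the gap to the linear bound, so the constant is minus half
    of it.\<close>
  proof (intro exI[of _ "\<lambda>j. - real_of_int (D (f j)) / 2"] conjI allI impI)
    fix j assume "j < R"
    then show "- real_of_int (D (f j)) / 2 < 0" using fpos[of j] by simp
  next
    show "\<forall>\<^sub>F n in sequentially. real (ex_cograph n s t) =
        - real_of_int (D (f (n mod R))) / 2 + ((real t - 1) / 2 + real s - 1) * real n"
      unfolding eventually_sequentially using ex const by metis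
  qed
  moreover have "\<forall>n\<ge>1. real (ex_cograph n s t) < ((real t - 1) / 2 + real s - 1) * real n"
    unfolding ex using pos by force
  ultimately show ?thesis
    using R q(1)
    \<comment> \<open>The sum bounds the order of every core; the added 1 makes the bound
      positive.\<close>
    by (intro conjI exI[of _ "(\<Sum>j<R. f j) + 1"] exI[of _ R] exI[of _ G] exI[of _ H] exI[of _ q]) auto
qed

end
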